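(* Let $\mathcal{A}=\mathcal{A}_n^{\bar q,\Lambda}(\mathbb{K})$ with no $q_k$ a root of unity. Every $\mathbb{K}$-algebra automorphism $h$ of $\mathcal{A}[t]=\mathcal{A}\otimes_{\mathbb{K}}\mathbb{K}[t]$ is triangular: there are $g\in\mathrm{Aut}_{\mathbb{K}}(\mathcal{A})$, $c\in\mathbb{K}^*$ and $r\in\mathbb{K}$ with $h|_{\mathcal{A}}=g$ and $h(t)=ct+r$; conversely every such data defines an automorphism. Thus $\mathrm{Aut}_{\mathbb{K}}(\mathcal{A}[t])=\begin{pmatrix}\mathrm{Aut}_{\mathbb{K}}(\mathcal{A}) & \mathbb{K}\\ 0 & \mathbb{K}^*\end{pmatrix}$. Moreover, if $\mathbb{K}$ has characteristic $0$, then the only locally nilpotent $\mathbb{K}$-derivation of $\mathcal{A}$ is $0$.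
   Context: Let $\mathbb{K}$ be a field, $n\ge 1$, $\bar q=(q_1,\dots,q_n)\in(\mathbb{K}^* )^n$, and $\Lambda=(\lambda_{ij})$ an $n\times n$ matrix over $\mathbb{K}^*$ with $\lambda_{ij}=\lambda_{ji}^{-1}$, $\lambda_{ii}=1$. $\mathcal{A}_n^{\bar q,\Lambda}(\mathbb{K})$ is the $\mathbb{K}$-algebra generated by $x_1,y_1,\dots,x_n,y_n$ with relations: for $1\le i<j\le n$, $x_ix_j=\lambda_{ij}x_jx_i$, $y_jy_i=\lambda_{ji}y_iy_j$, $x_iy_j=\lambda_{ji}y_jx_i$, $x_jy_i=\lambda_{ij}y_ix_j$; and $x_iy_i-q_iy_ix_i=1$ for all $i$. The matrix notation denotes the group of pairs $(g, (c,r))$ acting by $a\mapsto g(a)$ for $a\in\mathcal{A}$ and $t\mapsto ct+r$. A derivation $\partial$ is locally nilpotent if for each $a$ some power $\partial^k(a)=0$. *)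

theory Defs
  imports "HOL-Algebra.QuotRing" "HOL-Algebra.UnivPoly" "HOL-Library.Poly_Mapping"
begin

datatype gen = X nat | Y nat

definition gens :: "nat \<Rightarrow> gen set" where
  "gens n = {X i | i. 1 \<le> i \<and> i \<le> n} \<union> {Y i | i. 1 \<le> i \<and> i \<le> n}"

type_synonym 'k fa = "gen list \<Rightarrow>\<^sub>0 'k"

definition fa_mult :: "'k::comm_ring_1 fa \<Rightarrow> 'k fa \<Rightarrow> 'k fa" where
  "fa_mult p q = (\<Sum>u\<in>Poly_Mapping.keys p. \<Sum>v\<in>Poly_Mapping.keys q. Poly_Mapping.single (u @ v) (Poly_Mapping.lookup p u * Poly_Mapping.lookup q v))"

definition free_alg :: "nat \<Rightarrow> ('k::comm_ring_1 fa) ring" where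
  "free_alg n = \<lparr>carrier = {p. \<forall>w\<in>Poly_Mapping.keys p. set w \<subseteq> gens n},
                 mult = fa_mult, one = Poly_Mapping.single [] 1, zero = 0, add = (+)\<rparr>"

definition fa_sc :: "'k::comm_ring_1 \<Rightarrow> 'k fa" where
  "fa_sc c = Poly_Mapping.single [] c"

definition fa_gen :: "gen \<Rightarrow> 'k::comm_ring_1 fa" where
  "fa_gen g = Poly_Mapping.single [g] 1"

definition fa_x :: "nat \<Rightarrow> 'k::comm_ring_1 fa" where "fa_x i = fa_gen (X i)"
definition fa_y :: "nat \<Rightarrow> 'k::comm_ring_1 fa" where "fa_y i = fa_gen (Y i)"

definition qwa_rels :: "nat \<Rightarrow> (nat \<Rightarrow> 'k) \<Rightarrow> (nat \<Rightarrow> nat \<Rightarrow> 'k) \<Rightarrow> ('k::comm_ring_1 fa) set" where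
  "qwa_rels n q lam =
     {fa_mult (fa_x i) (fa_x j) - fa_mult (fa_sc (lam i j)) (fa_mult (fa_x j) (fa_x i))
        | i j. 1 \<le> i \<and> i < j \<and> j \<le> n}
   \<union> {fa_mult (fa_y j) (fa_y i) - fa_mult (fa_sc (lam j i)) (fa_mult (fa_y i) (fa_y j))
        | i j. 1 \<le> i \<and> i < j \<and> j \<le> n}
   \<union> {fa_mult (fa_x i) (fa_y j) - fa_mult (fa_sc (lam j i)) (fa_mult (fa_y j) (fa_x i))
        | i j. 1 \<le> i \<and> i < j \<and> j \<le> n}
   \<union> {fa_mult (fa_x j) (fa_y i) - fa_mult (fa_sc (lam i j)) (fa_mult (fa_y i) (fa_x j))
        | i j. 1 \<le> i \<and> i < j \<and> j \<le> n}
   \<union> {fa_mult (fa_x i) (fa_y i) - fa_mult (fa_sc (q i)) (fa_mult (fa_y i) (fa_x i)) - fa_sc 1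
        | i. 1 \<le> i \<and> i \<le> n}"

definition qwa :: "nat \<Rightarrow> (nat \<Rightarrow> 'k) \<Rightarrow> (nat \<Rightarrow> nat \<Rightarrow> 'k) \<Rightarrow> ('k::comm_ring_1 fa set) ring" where
  "qwa n q lam = free_alg n Quot (genideal (free_alg n) (qwa_rels n q lam))"

definition qwa_sc :: "nat \<Rightarrow> (nat \<Rightarrow> 'k) \<Rightarrow> (nat \<Rightarrow> nat \<Rightarrow> 'k) \<Rightarrow> 'k \<Rightarrow> ('k::comm_ring_1) fa set" where
  "qwa_sc n q lam c = genideal (free_alg n) (qwa_rels n q lam) +>\<^bsub>free_alg n\<^esub> fa_sc c"

definition alg_aut :: "('a, 'm) ring_scheme \<Rightarrow> ('k \<Rightarrow> 'a) \<Rightarrow> ('a \<Rightarrow> 'a) set" where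
  "alg_aut R iota = {h. h \<in> ring_iso R R \<and>
      (\<forall>c a. a \<in> carrier R \<longrightarrow> h (iota c \<otimes>\<^bsub>R\<^esub> a) = iota c \<otimes>\<^bsub>R\<^esub> h a)}"

definition alg_derivation :: "('a, 'm) ring_scheme \<Rightarrow> ('k \<Rightarrow> 'a) \<Rightarrow> ('a \<Rightarrow> 'a) \<Rightarrow> bool" where
  "alg_derivation R iota d \<longleftrightarrow>
     d \<in> carrier R \<rightarrow> carrier R \<and>
     (\<forall>a\<in>carrier R. \<forall>b\<in>carrier R. d (a \<oplus>\<^bsub>R\<^esub> b) = d a \<oplus>\<^bsub>R\<^esub> d b) \<and>
     (\<forall>a\<in>carrier R. \<forall>b\<in>carrier R.
        d (a \<otimes>\<^bsub>R\<^esub> b) = (d a \<otimes>\<^bsub>R\<^esub> b) \<oplus>\<^bsub>R\<^esub> (a \<otimes>\<^bsub>R\<^esub> d b)) \<and>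
     (\<forall>c. \<forall>a\<in>carrier R. d (iota c \<otimes>\<^bsub>R\<^esub> a) = iota c \<otimes>\<^bsub>R\<^esub> d a)"

definition locally_nilpotent :: "('a, 'm) ring_scheme \<Rightarrow> ('a \<Rightarrow> 'a) \<Rightarrow> bool" where
  "locally_nilpotent R d \<longleftrightarrow> (\<forall>a\<in>carrier R. \<exists>k. (d ^^ k) a = \<zero>\<^bsub>R\<^esub>)"

end

theory Submission
  imports Defs "HOL-Algebra.Subrings"
begin

text \<open>
  The algebra embeds into the quantum torus with generators \<open>x\<^sub>i, z\<^sub>i\<close>, where
  \<open>z\<^sub>i = x\<^sub>i y\<^sub>i - y\<^sub>i x\<^sub>i = 1 + (q\<^sub>i - 1) y\<^sub>i x\<^sub>i\<close>, by sending \<open>y\<^sub>i\<close> to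
  \<open>(q\<^sub>i - 1)\<inverse> (z\<^sub>i - 1) x\<^sub>i\<inverse>\<close>: the ordered monomials span, and their images have pairwise
  distinct leading exponents. Leading terms in the torus show that \<open>A\<close> is a domain and that two
  nonzero elements \<open>u, v\<close> inducing the same twist (\<open>u a = b u\<close> and \<open>v a = b v\<close>, with \<open>b\<close> depending
  only on \<open>a\<close>) are proportional, since no \<open>q\<^sub>i\<close> is a root of unity. In particular the centre of
  \<open>A[t]\<close> is \<open>K[t]\<close>.

  Let \<open>\<phi> : A \<rightarrow> A[t]\<close> be the restriction of an automorphism of \<open>A[t]\<close>, or the exponential
  \<open>exp (t d)\<close> of a locally nilpotent derivation \<open>d\<close>. By degrees in \<open>t\<close>, the elements that \<open>\<phi>\<close> maps
  to constants form a subalgebra closed under taking factors. It contains every normal element \<open>z\<close>: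
  the coefficients of \<open>\<phi> z\<close> all induce the same twist, so \<open>\<phi> z = f(t) w\<close> with \<open>w \<in> A\<close>. If \<open>\<phi>\<close>
  comes from an automorphism \<open>h\<close>, then \<open>h\<inverse> f\<close> is a central factor of \<open>z\<close>, hence a scalar; if
  \<open>\<phi> = exp (t d)\<close>, then \<open>d z\<close> is a multiple of \<open>z\<close>, hence \<open>0\<close>. As the \<open>z\<^sub>i\<close> are normal and \<open>y\<^sub>i x\<^sub>i\<close>
  is a linear function of \<open>z\<^sub>i\<close>, all of \<open>A\<close> is mapped to constants.
\<close>

section \<open>Algebras over a field\<close>

definition ring_center :: "('a, 'm) ring_scheme \<Rightarrow> 'a set" where
  "ring_center R = {z \<in> carrier R. \<forall>a\<in>carrier R. z \<otimes>\<^bsub>R\<^esub> a = a \<otimes>\<^bsub>R\<^esub> z}"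

definition same_twist :: "('a, 'm) ring_scheme \<Rightarrow> 'a \<Rightarrow> 'a \<Rightarrow> bool" where
  "same_twist R u v \<longleftrightarrow> u \<in> carrier R \<and> v \<in> carrier R \<and>
     (\<forall>a\<in>carrier R. \<exists>b\<in>carrier R. u \<otimes>\<^bsub>R\<^esub> a = b \<otimes>\<^bsub>R\<^esub> u \<and> v \<otimes>\<^bsub>R\<^esub> a = b \<otimes>\<^bsub>R\<^esub> v)"

definition normalized_by :: "('a, 'm) ring_scheme \<Rightarrow> 'a \<Rightarrow> 'a set" where
  "normalized_by R z = {a \<in> carrier R. \<exists>b\<in>carrier R. z \<otimes>\<^bsub>R\<^esub> a = b \<otimes>\<^bsub>R\<^esub> z}"

definition normal_elem :: "('a, 'm) ring_scheme \<Rightarrow> 'a \<Rightarrow> bool" where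
  "normal_elem R z \<longleftrightarrow> z \<in> carrier R \<and> carrier R \<subseteq> normalized_by R z"

lemma normal_elemD:
  assumes "normal_elem R z"
  shows "z \<in> carrier R" "a \<in> carrier R \<Longrightarrow> \<exists>b\<in>carrier R. z \<otimes>\<^bsub>R\<^esub> a = b \<otimes>\<^bsub>R\<^esub> z"
  using assms by (auto simp: normal_elem_def normalized_by_def)

lemma normal_elemI:
  assumes "z \<in> carrier R" "\<And>a. a \<in> carrier R \<Longrightarrow> \<exists>b\<in>carrier R. z \<otimes>\<^bsub>R\<^esub> a = b \<otimes>\<^bsub>R\<^esub> z"
  shows "normal_elem R z"
  using assms by (auto simp: normal_elem_def normalized_by_def)

definition factor_closed :: "('a, 'm) ring_scheme \<Rightarrow> 'a set \<Rightarrow> bool" where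
  "factor_closed R S \<longleftrightarrow> (\<forall>a\<in>carrier R. \<forall>b\<in>carrier R.
     a \<otimes>\<^bsub>R\<^esub> b \<in> S \<longrightarrow> a \<otimes>\<^bsub>R\<^esub> b \<noteq> \<zero>\<^bsub>R\<^esub> \<longrightarrow> a \<in> S \<and> b \<in> S)"

lemma ring_iso_inv_into:
  assumes "h \<in> ring_iso R S"
  shows "a \<in> carrier R \<Longrightarrow> inv_into (carrier R) h (h a) = a"
    and "b \<in> carrier S \<Longrightarrow> h (inv_into (carrier R) h b) = b"
  using assms unfolding ring_iso_def
  by (auto simp: bij_betw_inv_into_left bij_betw_inv_into_right)

lemma ring_iso_center:
  assumes h: "h \<in> ring_iso R S" and z: "z \<in> ring_center R"
  shows "h z \<in> ring_center S"
  unfolding ring_center_def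
proof (intro CollectI conjI ballI)
  have hom: "h \<in> ring_hom R S" and onto: "h ` carrier R = carrier S"
    using h by (auto simp: ring_iso_def bij_betw_def)
  have z': "z \<in> carrier R" "\<And>a. a \<in> carrier R \<Longrightarrow> z \<otimes>\<^bsub>R\<^esub> a = a \<otimes>\<^bsub>R\<^esub> z"
    using z by (auto simp: ring_center_def)
  then show "h z \<in> carrier S" using hom by (blast intro: ring_hom_closed)
  fix b assume "b \<in> carrier S"
  then obtain a where "a \<in> carrier R" "b = h a" using onto by blast
  then show "h z \<otimes>\<^bsub>S\<^esub> b = b \<otimes>\<^bsub>S\<^esub> h z" using z' by (simp flip: ring_hom_mult[OF hom])
qed

lemma ring_iso_normal_elem:
  assumes h: "h \<in> ring_iso R S" and z: "normal_elem R z"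
  shows "normal_elem S (h z)"
proof (rule normal_elemI)
  have hom: "h \<in> ring_hom R S" and onto: "h ` carrier R = carrier S"
    using h by (auto simp: ring_iso_def bij_betw_def)
  note z_closed = normal_elemD(1)[OF z]
  then show "h z \<in> carrier S" by (rule ring_hom_closed[OF hom])
  fix x assume "x \<in> carrier S"
  then obtain a where a: "a \<in> carrier R" "x = h a" using onto by blast
  obtain b where b: "b \<in> carrier R" "z \<otimes>\<^bsub>R\<^esub> a = b \<otimes>\<^bsub>R\<^esub> z"
    using normal_elemD(2)[OF z a(1)] by blast
  show "\<exists>y\<in>carrier S. h z \<otimes>\<^bsub>S\<^esub> x = y \<otimes>\<^bsub>S\<^esub> h z"
    using a b z_closed ring_hom_closed[OF hom]
    by (intro bexI[of _ "h b"]) (simp_all flip: ring_hom_mult[OF hom])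
qed

lemma (in ring) center_subring: "subring (ring_center R) R"
proof (rule subringI)
  fix a b assume ab: "a \<in> ring_center R" "b \<in> ring_center R"
  then have closed: "a \<in> carrier R" "b \<in> carrier R" by (auto simp: ring_center_def)
  have commute: "a \<otimes> x = x \<otimes> a" "b \<otimes> x = x \<otimes> b" if "x \<in> carrier R" for x
    using ab that by (auto simp: ring_center_def)
  have "(a \<oplus> b) \<otimes> x = x \<otimes> (a \<oplus> b)" if "x \<in> carrier R" for x
    using closed that commute[OF that] by (simp only: l_distr r_distr)
  then show "a \<oplus> b \<in> ring_center R" using closed by (simp add: ring_center_def)
  have "(a \<otimes> b) \<otimes> x = x \<otimes> (a \<otimes> b)" if "x \<in> carrier R" for x
  proof -
    have "(a \<otimes> b) \<otimes> x = (a \<otimes> x) \<otimes> b" using closed that by (simp only: m_assoc commute(2))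
    then show ?thesis using closed that by (simp only: m_assoc commute(1))
  qed
  then show "a \<otimes> b \<in> ring_center R" using closed by (simp add: ring_center_def)
qed (auto simp: ring_center_def l_minus r_minus)

locale noncomm_domain = ring +
  assumes one_not_zero: "\<one> \<noteq> \<zero>"
    and integral: "a \<in> carrier R \<Longrightarrow> b \<in> carrier R \<Longrightarrow> a \<otimes> b = \<zero> \<Longrightarrow> a = \<zero> \<or> b = \<zero>"

locale scalar_algebra = ring R for R (structure) +
  fixes iota :: "'k::field \<Rightarrow> 'a"
  assumes iota_closed [simp]: "iota c \<in> carrier R"
    and iota_add: "iota (c + d) = iota c \<oplus> iota d"
    and iota_mult: "iota (c * d) = iota c \<otimes> iota d"
    and iota_one: "iota 1 = \<one>"
    and iota_central: "iota c \<in> ring_center R"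
begin

lemma iota_commute: "a \<in> carrier R \<Longrightarrow> iota c \<otimes> a = a \<otimes> iota c"
  using iota_central by (simp add: ring_center_def)

lemma iota_left_commute:
  "a \<in> carrier R \<Longrightarrow> b \<in> carrier R \<Longrightarrow> a \<otimes> (iota c \<otimes> b) = iota c \<otimes> (a \<otimes> b)"
  by (metis iota_closed iota_commute m_assoc)

lemma iota_zero [simp]: "iota 0 = \<zero>"
  using iota_add[of 0 0] add.l_cancel_one'[of "iota 0" "iota 0"] by simp

lemma iota_minus: "iota (- c) = \<ominus> iota c"
  using iota_add[of "- c" c] by (intro minus_equality[symmetric]) auto

lemma iota_inverse_mult:
  assumes "c \<noteq> 0" "a \<in> carrier R"
  shows "iota (inverse c) \<otimes> (iota c \<otimes> a) = a"
  using assms by (metis iota_closed iota_mult iota_one l_one left_inverse m_assoc)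

lemma iota_mult_cancel:
  assumes "c \<noteq> 0" "a \<in> carrier R" "b \<in> carrier R" "iota c \<otimes> a = iota c \<otimes> b"
  shows "a = b"
  using assms iota_inverse_mult by metis

lemma subring_scalarsI:
  assumes "S \<subseteq> carrier R" "\<And>c. iota c \<in> S"
    and "\<And>a b. a \<in> S \<Longrightarrow> b \<in> S \<Longrightarrow> a \<oplus> b \<in> S"
    and "\<And>a b. a \<in> S \<Longrightarrow> b \<in> S \<Longrightarrow> a \<otimes> b \<in> S"
  shows "subring S R"
proof (rule subringI)
  show "\<one> \<in> S" using assms(2)[of 1] by (simp add: iota_one)
  show "\<ominus> a \<in> S" if "a \<in> S" for a
  proof -
    have "a \<in> carrier R" using that assms(1) by blast
    then have "\<ominus> a = iota (- 1) \<otimes> a" by (simp add: iota_minus iota_one l_minus)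
    then show ?thesis using that assms(2,4) by metis
  qed
qed (use assms in auto)

lemma normalized_by_subring:
  assumes z: "z \<in> carrier R"
  shows "subring (normalized_by R z) R"
proof (rule subring_scalarsI)
  fix a a' assume "a \<in> normalized_by R z" "a' \<in> normalized_by R z"
  then obtain b b' where a: "a \<in> carrier R" "b \<in> carrier R" "z \<otimes> a = b \<otimes> z"
    and a': "a' \<in> carrier R" "b' \<in> carrier R" "z \<otimes> a' = b' \<otimes> z"
    unfolding normalized_by_def by blast
  have "z \<otimes> (a \<oplus> a') = (b \<oplus> b') \<otimes> z"
    using z a a' by (simp add: l_distr r_distr)
  moreover have "z \<otimes> (a \<otimes> a') = (b \<otimes> b') \<otimes> z"
    using z a a' by (metis m_assoc)
  ultimately show "a \<oplus> a' \<in> normalized_by R z" "a \<otimes> a' \<in> normalized_by R z"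
    using a a' unfolding normalized_by_def by blast+
next
  show "iota c \<in> normalized_by R z" for c
    using iota_commute[OF z, of c] by (auto simp: normalized_by_def intro!: bexI[of _ "iota c"])
qed (auto simp: normalized_by_def)

lemma alg_autD:
  assumes "h \<in> alg_aut R iota"
  shows "h \<in> ring_iso R R" "h \<in> ring_hom R R" "bij_betw h (carrier R) (carrier R)"
    "h (iota c) = iota c"
proof -
  show iso: "h \<in> ring_iso R R" using assms by (simp add: alg_aut_def)
  then show hom: "h \<in> ring_hom R R" and "bij_betw h (carrier R) (carrier R)"
    by (auto simp: ring_iso_def)
  have "h (iota c \<otimes> \<one>) = iota c \<otimes> h \<one>"
    using assms one_closed unfolding alg_aut_def by blast
  then show "h (iota c) = iota c" using ring_hom_one[OF hom] by simp
qed

lemma alg_autI: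
  assumes "h \<in> ring_iso R R" "\<And>c. h (iota c) = iota c"
  shows "h \<in> alg_aut R iota"
  using assms by (auto simp: alg_aut_def ring_iso_def ring_hom_mult)

lemma alg_aut_inverse:
  assumes "h \<in> alg_aut R iota"
  shows "inv_into (carrier R) h \<in> alg_aut R iota"
proof (rule alg_autI)
  note iso = alg_autD(1)[OF assms]
  show "inv_into (carrier R) h \<in> ring_iso R R"
    by (rule ring_iso_set_sym[OF ring_axioms iso])
  show "inv_into (carrier R) h (iota c) = iota c" for c
    using ring_iso_inv_into(1)[OF iso iota_closed] alg_autD(4)[OF assms] by simp
qed

end

section \<open>Polynomials over a noncommutative ring\<close>

context UP_ring
begin

abbreviation const :: "'a \<Rightarrow> nat \<Rightarrow> 'a" where "const a \<equiv> monom P a 0"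

abbreviation indet :: "nat \<Rightarrow> 'a" where "indet \<equiv> monom P \<one> 1"

lemma coeff_mult_const:
  assumes "p \<in> carrier P" "a \<in> carrier R"
  shows "coeff P (p \<otimes>\<^bsub>P\<^esub> const a) n = coeff P p n \<otimes> a"
proof -
  have "coeff P (p \<otimes>\<^bsub>P\<^esub> const a) n = (\<Oplus>i\<in>{..n}. if n = i then coeff P p i \<otimes> a else \<zero>)"
    using assms by (simp, intro R.finsum_cong') auto
  also have "\<dots> = coeff P p n \<otimes> a"
    using assms by (subst R.finsum_singleton) auto
  finally show ?thesis .
qed

lemma coeff_const_mult:
  assumes "p \<in> carrier P" "a \<in> carrier R"
  shows "coeff P (const a \<otimes>\<^bsub>P\<^esub> p) n = a \<otimes> coeff P p n"
  using assms by (simp only: monom_mult_is_smult coeff_smult)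

lemma poly_with_coeffs_exists:
  assumes "\<And>n. f n \<in> carrier R" "\<And>n. n > N \<Longrightarrow> f n = \<zero>"
  obtains p where "p \<in> carrier P" "\<And>n. coeff P p n = f n"
proof
  have "f \<in> up R" using assms by (intro mem_upI exI[of _ N] bound.intro) auto
  then show "f \<in> carrier P" "coeff P f n = f n" for n by (simp_all add: P_def UP_def)
qed

lemma coeff_induct [consumes 1, case_names monom add]:
  assumes p: "p \<in> carrier P"
    and "\<And>n. Q (monom P (coeff P p n) n)"
    and "\<And>p q. p \<in> carrier P \<Longrightarrow> q \<in> carrier P \<Longrightarrow> Q p \<Longrightarrow> Q q \<Longrightarrow> Q (p \<oplus>\<^bsub>P\<^esub> q)"
  shows "Q p"
proof -
  have "Q (\<Oplus>\<^bsub>P\<^esub>i\<in>{..k}. monom P (coeff P p i) i)" for k :: nat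
  proof (induction k)
    case 0
    have "(\<Oplus>\<^bsub>P\<^esub>i\<in>{..0}. monom P (coeff P p i) i) = monom P (coeff P p 0) 0"
      using p by (subst P.finsum_0) auto
    then show ?case using assms(2)[of 0] by simp
  next
    case (Suc k)
    have "(\<Oplus>\<^bsub>P\<^esub>i\<in>{..Suc k}. monom P (coeff P p i) i)
       = monom P (coeff P p (Suc k)) (Suc k) \<oplus>\<^bsub>P\<^esub> (\<Oplus>\<^bsub>P\<^esub>i\<in>{..k}. monom P (coeff P p i) i)"
      using p by (subst P.finsum_Suc) auto
    with Suc show ?case using assms by (auto intro!: P.finsum_closed)
  qed
  then show ?thesis using up_repr[OF p] by metis
qed

lemma UP_induct [consumes 1, case_names monom add]:
  assumes "p \<in> carrier P"
    and "\<And>a n. a \<in> carrier R \<Longrightarrow> Q (monom P a n)"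
    and "\<And>p q. p \<in> carrier P \<Longrightarrow> q \<in> carrier P \<Longrightarrow> Q p \<Longrightarrow> Q q \<Longrightarrow> Q (p \<oplus>\<^bsub>P\<^esub> q)"
  shows "Q p"
  using assms(1)
proof (induction rule: coeff_induct)
  case (monom n)
  show ?case using assms(1) by (intro assms(2)) simp
qed (rule assms(3))

lemma deg_eq_0_iff_const:
  assumes "p \<in> carrier P"
  shows "deg R p = 0 \<longleftrightarrow> (\<exists>a\<in>carrier R. p = const a)"
  using assms deg_zero_impl_monom[OF assms] by (metis coeff_closed deg_const)

lemma const_eq_iff:
  "a \<in> carrier R \<Longrightarrow> b \<in> carrier R \<Longrightarrow> const a = const b \<longleftrightarrow> a = b"
  by (rule inj_on_eq_iff[OF monom_inj])

lemma const_eq_zero_iff: "a \<in> carrier R \<Longrightarrow> const a = \<zero>\<^bsub>P\<^esub> \<longleftrightarrow> a = \<zero>"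
  using const_eq_iff[of a \<zero>] by simp

lemma const_mult_monom:
  "a \<in> carrier R \<Longrightarrow> b \<in> carrier R \<Longrightarrow> const a \<otimes>\<^bsub>P\<^esub> monom P b n = monom P (a \<otimes> b) n"
  using monom_mult[of a b 0 n] by simp

lemma monom_mult_const:
  "a \<in> carrier R \<Longrightarrow> b \<in> carrier R \<Longrightarrow> monom P a n \<otimes>\<^bsub>P\<^esub> const b = monom P (a \<otimes> b) n"
  using monom_mult[of a b n 0] by simp

lemma monom_eq_const_mult_indet_pow:
  assumes "a \<in> carrier R"
  shows "monom P a n = const a \<otimes>\<^bsub>P\<^esub> indet [^]\<^bsub>P\<^esub> n"
proof -
  have "indet [^]\<^bsub>P\<^esub> k = monom P \<one> k" for k :: nat
  proof (induction k)
    case (Suc k)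
    then show ?case using monom_one_Suc[of k] by simp
  qed simp
  then show ?thesis using assms const_mult_monom[of a \<one> n] by simp
qed

lemma indet_central: "indet \<in> ring_center P"
proof -
  have "indet \<otimes>\<^bsub>P\<^esub> p = p \<otimes>\<^bsub>P\<^esub> indet" if "p \<in> carrier P" for p
    using that
  proof (induction rule: UP_induct)
    case (monom a n)
    then show ?case using monom_mult[of \<one> a 1 n] monom_mult[of a \<one> n 1] by simp
  qed (simp add: P.l_distr P.r_distr)
  then show ?thesis by (simp add: ring_center_def)
qed

lemma coeff_indet_mult:
  assumes "p \<in> carrier P"
  shows "coeff P (indet \<otimes>\<^bsub>P\<^esub> p) 0 = \<zero>" "coeff P (indet \<otimes>\<^bsub>P\<^esub> p) (Suc n) = coeff P p n"
  using assms coeff_monom_mult[of \<one> p 1 n] by simp_all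

lemma indet_dvd:
  assumes p: "p \<in> carrier P" and "coeff P p 0 = \<zero>"
  obtains q where "q \<in> carrier P" "p = indet \<otimes>\<^bsub>P\<^esub> q" "\<And>n. coeff P q n = coeff P p (Suc n)"
proof -
  obtain q where q: "q \<in> carrier P" "\<And>n. coeff P q n = coeff P p (Suc n)"
    using poly_with_coeffs_exists[of "\<lambda>n. coeff P p (Suc n)" "deg R p"] p
    by (auto simp: deg_aboveD)
  have "p = indet \<otimes>\<^bsub>P\<^esub> q"
  proof (rule up_eqI)
    fix n show "coeff P p n = coeff P (indet \<otimes>\<^bsub>P\<^esub> q) n"
      by (cases n) (use q assms coeff_indet_mult[of q] in \<open>simp_all del: coeff_mult\<close>)
  qed (use q assms in auto)
  with q that show thesis by blast
qed

lemma subring_containsI: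
  assumes S: "subring S P" "indet \<in> S" and p: "p \<in> carrier P" "\<And>n. const (coeff P p n) \<in> S"
  shows "p \<in> S"
  using p(1)
proof (induction rule: coeff_induct)
  case (monom n)
  have "indet [^]\<^bsub>P\<^esub> k \<in> S" for k :: nat
    using S(2) subringE(3,6)[OF S(1)] by (induction k) (simp_all del: One_nat_def)
  then have "const (coeff P p n) \<otimes>\<^bsub>P\<^esub> indet [^]\<^bsub>P\<^esub> n \<in> S"
    by (intro subringE(6)[OF S(1)] p(2))
  then show ?case
    using monom_eq_const_mult_indet_pow[OF coeff_closed[OF p(1)], of n n] by simp
qed (use subringE(7)[OF S(1)] in blast)

lemma hom_eqI:
  assumes H: "H \<in> ring_hom P S" "H' \<in> ring_hom P S" and S: "ring S"
    and eq: "\<And>a. a \<in> carrier R \<Longrightarrow> H (const a) = H' (const a)" "H indet = H' indet"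
    and p: "p \<in> carrier P"
  shows "H p = H' p"
  using p
proof (induction rule: UP_induct)
  case (monom a n)
  have "F (monom P a n) = F (const a) \<otimes>\<^bsub>S\<^esub> F indet [^]\<^bsub>S\<^esub> n" if "F \<in> ring_hom P S" for F
  proof -
    interpret F: ring_hom_ring P S F
      using P.ring_axioms S that by (simp add: ring_hom_ring_def ring_hom_ring_axioms_def)
    show ?thesis 
      unfolding monom_eq_const_mult_indet_pow[OF monom, of n] using monom F.hom_nat_pow[of indet n]
      by (simp del: One_nat_def)
  qed
  then show ?case using H eq(1)[OF monom] eq(2) by metis
next
  case (add p q)
  then show ?case using H by (simp add: ring_hom_add)
qed

end

locale UP_eval_commuting = UP_ring R P + S: ring S
  for R (structure) and P (structure) and S (structure) +
  fixes \<phi> :: "'a \<Rightarrow> 'c" and s :: 'c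
  assumes hom: "\<phi> \<in> ring_hom R S" and point_closed [simp]: "s \<in> carrier S"
    and commute: "a \<in> carrier R \<Longrightarrow> \<phi> a \<otimes>\<^bsub>S\<^esub> s = s \<otimes>\<^bsub>S\<^esub> \<phi> a"
begin

abbreviation ev :: "(nat \<Rightarrow> 'a) \<Rightarrow> 'c" where "ev \<equiv> eval R S \<phi> s"

lemma hom_closed [simp]: "a \<in> carrier R \<Longrightarrow> \<phi> a \<in> carrier S"
  by (rule ring_hom_closed[OF hom])

lemma hom_zero: "\<phi> \<zero> = \<zero>\<^bsub>S\<^esub>"
  by (rule ring_hom_zero[OF hom R.ring_axioms S.ring_axioms])

lemma eval_upto:
  assumes "p \<in> carrier P" "deg R p \<le> N"
  shows "ev p = (\<Oplus>\<^bsub>S\<^esub>i\<in>{..N}. \<phi> (coeff P p i) \<otimes>\<^bsub>S\<^esub> s [^]\<^bsub>S\<^esub> i)"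
  unfolding eval_on_carrier[OF assms(1)] using assms deg_aboveD hom_zero
  by (intro S.add.finprod_mono_neutral_cong_left) auto

lemma eval_closed [simp]: "p \<in> carrier P \<Longrightarrow> ev p \<in> carrier S"
  by (auto simp: eval_on_carrier intro: S.finsum_closed)

lemma eval_add:
  assumes p: "p \<in> carrier P" and q: "q \<in> carrier P"
  shows "ev (p \<oplus>\<^bsub>P\<^esub> q) = ev p \<oplus>\<^bsub>S\<^esub> ev q"
proof -
  define N where "N = max (deg R p) (deg R q)"
  have "ev (p \<oplus>\<^bsub>P\<^esub> q) = (\<Oplus>\<^bsub>S\<^esub>i\<in>{..N}. \<phi> (coeff P (p \<oplus>\<^bsub>P\<^esub> q) i) \<otimes>\<^bsub>S\<^esub> s [^]\<^bsub>S\<^esub> i)"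
    using p q by (intro eval_upto) (simp_all add: N_def)
  also have "\<dots> = (\<Oplus>\<^bsub>S\<^esub>i\<in>{..N}. \<phi> (coeff P p i) \<otimes>\<^bsub>S\<^esub> s [^]\<^bsub>S\<^esub> i
      \<oplus>\<^bsub>S\<^esub> \<phi> (coeff P q i) \<otimes>\<^bsub>S\<^esub> s [^]\<^bsub>S\<^esub> i)"
    using p q by (intro S.finsum_cong') (auto simp: ring_hom_add[OF hom] S.l_distr)
  also have "\<dots> = ev p \<oplus>\<^bsub>S\<^esub> ev q"
    using p q by (subst S.finsum_addf) (auto simp: eval_upto[of _ N] N_def)
  finally show ?thesis .
qed

lemma eval_monom:
  assumes a: "a \<in> carrier R"
  shows "ev (monom P a n) = \<phi> a \<otimes>\<^bsub>S\<^esub> s [^]\<^bsub>S\<^esub> n"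
proof -
  have "ev (monom P a n) = (\<Oplus>\<^bsub>S\<^esub>i\<in>{..n}. \<phi> (coeff P (monom P a n) i) \<otimes>\<^bsub>S\<^esub> s [^]\<^bsub>S\<^esub> i)"
    using a by (intro eval_upto) (auto intro: deg_monom_le)
  also have "\<dots> = (\<Oplus>\<^bsub>S\<^esub>i\<in>{..n}. if n = i then \<phi> a \<otimes>\<^bsub>S\<^esub> s [^]\<^bsub>S\<^esub> i else \<zero>\<^bsub>S\<^esub>)"
    using a by (intro S.finsum_cong') (auto simp: hom_zero)
  also have "\<dots> = \<phi> a \<otimes>\<^bsub>S\<^esub> s [^]\<^bsub>S\<^esub> n"
    using a by (subst S.finsum_singleton) auto
  finally show ?thesis .
qed

lemma eval_const: "a \<in> carrier R \<Longrightarrow> ev (const a) = \<phi> a"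
  using eval_monom[of a 0] by simp

lemma eval_indet: "ev indet = s"
  using eval_monom[of \<one> 1] by (simp add: ring_hom_one[OF hom])

lemma pow_commute:
  assumes "a \<in> carrier R"
  shows "s [^]\<^bsub>S\<^esub> (n::nat) \<otimes>\<^bsub>S\<^esub> \<phi> a = \<phi> a \<otimes>\<^bsub>S\<^esub> s [^]\<^bsub>S\<^esub> n"
proof (induction n)
  case (Suc n)
  have "s [^]\<^bsub>S\<^esub> Suc n \<otimes>\<^bsub>S\<^esub> \<phi> a = s [^]\<^bsub>S\<^esub> n \<otimes>\<^bsub>S\<^esub> (\<phi> a \<otimes>\<^bsub>S\<^esub> s)"
    using assms by (simp add: S.m_assoc commute)
  also have "\<dots> = \<phi> a \<otimes>\<^bsub>S\<^esub> s [^]\<^bsub>S\<^esub> Suc n"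
    using assms Suc by (simp flip: S.m_assoc)
  finally show ?case .
qed (use assms in simp)

lemma eval_mult_monom:
  assumes a: "a \<in> carrier R" and b: "b \<in> carrier R"
  shows "ev (monom P a m \<otimes>\<^bsub>P\<^esub> monom P b n) = ev (monom P a m) \<otimes>\<^bsub>S\<^esub> ev (monom P b n)"
proof -
  have "ev (monom P a m) \<otimes>\<^bsub>S\<^esub> ev (monom P b n)
      = \<phi> a \<otimes>\<^bsub>S\<^esub> ((s [^]\<^bsub>S\<^esub> m \<otimes>\<^bsub>S\<^esub> \<phi> b) \<otimes>\<^bsub>S\<^esub> s [^]\<^bsub>S\<^esub> n)"
    using a b by (simp add: eval_monom S.m_assoc)
  also have "\<dots> = (\<phi> a \<otimes>\<^bsub>S\<^esub> \<phi> b) \<otimes>\<^bsub>S\<^esub> (s [^]\<^bsub>S\<^esub> m \<otimes>\<^bsub>S\<^esub> s [^]\<^bsub>S\<^esub> n)"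
    using a b by (simp add: pow_commute S.m_assoc)
  also have "\<dots> = ev (monom P (a \<otimes> b) (m + n))"
    using a b by (simp add: eval_monom S.nat_pow_mult ring_hom_mult[OF hom] del: monom_mult)
  finally show ?thesis using a b by simp
qed

lemma eval_mult:
  assumes p: "p \<in> carrier P" and q: "q \<in> carrier P"
  shows "ev (p \<otimes>\<^bsub>P\<^esub> q) = ev p \<otimes>\<^bsub>S\<^esub> ev q"
  using p
proof (induction rule: UP_induct)
  case (monom a m)
  show ?case
    using q
  proof (induction rule: UP_induct)
    case (monom b n)
    then show ?case using \<open>a \<in> carrier R\<close> by (rule eval_mult_monom[rotated])
  next
    case (add q q')
    then show ?case using monom by (simp add: P.r_distr eval_add S.r_distr)
  qed
next
  case (add p p')
  then show ?case using q by (simp add: P.l_distr eval_add S.l_distr)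
qed

lemma eval_hom: "ev \<in> ring_hom P S"
proof (rule ring_hom_memI)
  show "ev \<one>\<^bsub>P\<^esub> = \<one>\<^bsub>S\<^esub>" using eval_const[of \<one>] by (simp add: ring_hom_one[OF hom])
qed (simp_all add: eval_add eval_mult)

end

locale UP_noncomm_domain = UP_ring R P + noncomm_domain R for R (structure) and P (structure)
begin

lemma coeff_mult_deg_add:
  assumes p: "p \<in> carrier P" and q: "q \<in> carrier P"
  shows "coeff P (p \<otimes>\<^bsub>P\<^esub> q) (deg R p + deg R q) = coeff P p (deg R p) \<otimes> coeff P q (deg R q)"
proof -
  let ?m = "deg R p" and ?n = "deg R q"
  have "coeff P (p \<otimes>\<^bsub>P\<^esub> q) (?m + ?n)
      = (\<Oplus>i\<in>{..?m + ?n}. if ?m = i then coeff P p i \<otimes> coeff P q ?n else \<zero>)"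
  proof (subst coeff_mult[OF p q], rule R.finsum_cong')
    fix i assume "i \<in> {..?m + ?n}"
    consider "i < ?m" | "i = ?m" | "i > ?m" by linarith
    then show "coeff P p i \<otimes> coeff P q (?m + ?n - i)
        = (if ?m = i then coeff P p i \<otimes> coeff P q ?n else \<zero>)"
      by cases (use p q in \<open>auto simp: deg_aboveD\<close>)
  qed (use p q in auto)
  also have "\<dots> = coeff P p ?m \<otimes> coeff P q ?n"
    using p q by (subst R.finsum_singleton) auto
  finally show ?thesis .
qed

lemma
  assumes p: "p \<in> carrier P" "p \<noteq> \<zero>\<^bsub>P\<^esub>" and q: "q \<in> carrier P" "q \<noteq> \<zero>\<^bsub>P\<^esub>"
  shows deg_mult: "deg R (p \<otimes>\<^bsub>P\<^esub> q) = deg R p + deg R q"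
    and mult_neq_0: "p \<otimes>\<^bsub>P\<^esub> q \<noteq> \<zero>\<^bsub>P\<^esub>"
proof -
  have lead: "coeff P (p \<otimes>\<^bsub>P\<^esub> q) (deg R p + deg R q) \<noteq> \<zero>"
    unfolding coeff_mult_deg_add[OF p(1) q(1)] using p q integral lcoeff_nonzero2 coeff_closed
    by blast
  then show "p \<otimes>\<^bsub>P\<^esub> q \<noteq> \<zero>\<^bsub>P\<^esub>" using coeff_zero by metis
  have "deg R p + deg R q \<le> deg R (p \<otimes>\<^bsub>P\<^esub> q)" using lead p q by (intro deg_belowI) auto
  then show "deg R (p \<otimes>\<^bsub>P\<^esub> q) = deg R p + deg R q" using deg_mult_ring[OF p(1) q(1)] by simp
qed

lemma deg_factors:
  assumes "p \<in> carrier P" "q \<in> carrier P" "p \<otimes>\<^bsub>P\<^esub> q \<noteq> \<zero>\<^bsub>P\<^esub>"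
  shows "deg R p + deg R q = deg R (p \<otimes>\<^bsub>P\<^esub> q)"
  using assms by (intro deg_mult[symmetric]) auto

lemma indet_neq_const: "a \<in> carrier R \<Longrightarrow> indet \<noteq> const a"
  using one_not_zero coeff_monom[of \<one> 1 1] coeff_monom[of a 0 1]
  by (metis R.one_closed zero_neq_one)

text \<open>By degrees, \<open>b\<close> is a constant in \<open>u a = b u\<close>.\<close>

lemma same_twist_coeffs:
  assumes u: "u \<in> carrier P" "u \<noteq> \<zero>\<^bsub>P\<^esub>"
    and normalizes: "\<And>a. a \<in> carrier R \<Longrightarrow> \<exists>b\<in>carrier P. u \<otimes>\<^bsub>P\<^esub> const a = b \<otimes>\<^bsub>P\<^esub> u"
  shows "same_twist R (coeff P u i) (coeff P u j)"
proof -
  have "\<exists>b\<in>carrier R. \<forall>k. coeff P u k \<otimes> a = b \<otimes> coeff P u k" if a: "a \<in> carrier R" for a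
  proof (cases "a = \<zero>")
    case True
    then show ?thesis using u by (intro bexI[of _ \<zero>]) auto
  next
    case False
    then have aP: "const a \<in> carrier P" "const a \<noteq> \<zero>\<^bsub>P\<^esub>" using a const_eq_zero_iff by auto
    obtain b where b: "b \<in> carrier P" "u \<otimes>\<^bsub>P\<^esub> const a = b \<otimes>\<^bsub>P\<^esub> u" using normalizes[OF a] by blast
    have "b \<otimes>\<^bsub>P\<^esub> u \<noteq> \<zero>\<^bsub>P\<^esub>" using mult_neq_0[OF u aP] b(2) by simp
    then have "deg R b + deg R u = deg R u + 0"
      using deg_factors[OF b(1) u(1)] deg_mult[OF u aP] b(2) a by simp
    then obtain c where c: "c \<in> carrier R" "b = const c" using deg_eq_0_iff_const[OF b(1)] by auto
    have "coeff P u k \<otimes> a = c \<otimes> coeff P u k" for k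
      using b c a u coeff_mult_const coeff_const_mult by metis
    then show ?thesis using c by blast
  qed
  then show ?thesis using u unfolding same_twist_def by (meson coeff_closed)
qed

end

section \<open>Triangular automorphisms of polynomial algebras\<close>

locale UP_scalar_algebra = UP_ring R P + scalar_algebra R iota
  for R :: "('a, 'm) ring_scheme" (structure) and P (structure) and iota :: "'k::field \<Rightarrow> 'a"
begin

abbreviation iotaP :: "'k \<Rightarrow> nat \<Rightarrow> 'a" where "iotaP \<equiv> (\<lambda>c. const (iota c))"

lemma iotaP_central: "iotaP c \<in> ring_center P"
  unfolding ring_center_def
proof (intro CollectI conjI ballI up_eqI)
  fix p n assume "p \<in> carrier P"
  then show "coeff P (iotaP c \<otimes>\<^bsub>P\<^esub> p) n = coeff P (p \<otimes>\<^bsub>P\<^esub> iotaP c) n"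
    by (simp only: coeff_const_mult coeff_mult_const iota_closed iota_commute coeff_closed)
qed simp_all

end

sublocale UP_scalar_algebra \<subseteq> P: scalar_algebra P iotaP
  by unfold_locales (simp_all add: iota_add iota_mult iota_one const_mult_monom iotaP_central)

context UP_scalar_algebra
begin

lemma scalar_coeffs_central:
  assumes "p \<in> carrier P" "\<And>n. coeff P p n \<in> range iota"
  shows "p \<in> ring_center P"
proof (rule subring_containsI[OF P.center_subring indet_central assms(1)])
  show "const (coeff P p n) \<in> ring_center P" for n
    using assms(2)[of n] iotaP_central by auto
qed

definition triangular ::
  "((nat \<Rightarrow> 'a) \<Rightarrow> nat \<Rightarrow> 'a) \<Rightarrow> ('a \<Rightarrow> 'a) \<Rightarrow> 'k \<Rightarrow> 'k \<Rightarrow> bool" where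
  "triangular h g c r \<longleftrightarrow> (\<forall>a\<in>carrier R. h (const a) = const (g a)) \<and>
     h indet = monom P (iota c) 1 \<oplus>\<^bsub>P\<^esub> iotaP r"

lemma monom_iota_1: "monom P (iota c) 1 = iotaP c \<otimes>\<^bsub>P\<^esub> indet"
  using const_mult_monom[of "iota c" \<one> 1] by simp

lemma triangular_hom_exists:
  assumes g: "g \<in> ring_hom R R"
  obtains H where "H \<in> ring_hom P P" "triangular H g c r"
proof -
  define s where "s = monom P (iota c) 1 \<oplus>\<^bsub>P\<^esub> iotaP r"
  have "s \<in> ring_center P"
    unfolding s_def monom_iota_1
    using subringE(6,7)[OF P.center_subring] iotaP_central indet_central by blast
  moreover have "const \<circ> g \<in> ring_hom R P"
    using ring_hom_trans[OF g const_ring_hom] by (simp add: comp_def)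
  ultimately interpret UP_eval_commuting R P P "const \<circ> g" s
    using ring_hom_closed[OF g]
    by unfold_locales (auto simp: ring_center_def)
  have "triangular (eval R P (const \<circ> g) s) g c r"
    using eval_const eval_indet by (simp add: triangular_def s_def)
  with eval_hom show thesis by (rule that)
qed

lemma triangular_comp:
  assumes H: "H \<in> ring_hom P P" "triangular H g c r"
    and H': "triangular H' g' c' r'"
    and g: "\<And>c. g (iota c) = iota c" and g': "\<And>a. a \<in> carrier R \<Longrightarrow> g' a \<in> carrier R"
  shows "triangular (H \<circ> H') (g \<circ> g') (c * c') (c' * r + r')"
proof -
  have H_iotaP: "H (iotaP c) = iotaP c" for c
    using H(2) g by (simp add: triangular_def)
  have "H (H' indet) = H (iotaP c' \<otimes>\<^bsub>P\<^esub> indet \<oplus>\<^bsub>P\<^esub> iotaP r')"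
    using H' by (simp only: triangular_def monom_iota_1)
  also have "\<dots> = iotaP c' \<otimes>\<^bsub>P\<^esub> H indet \<oplus>\<^bsub>P\<^esub> iotaP r'"
    by (simp only: ring_hom_add[OF H(1)] ring_hom_mult[OF H(1)] H_iotaP
        P.iota_closed P.m_closed monom_closed R.one_closed)
  also have "\<dots> = iotaP c' \<otimes>\<^bsub>P\<^esub> (monom P (iota c) 1 \<oplus>\<^bsub>P\<^esub> iotaP r) \<oplus>\<^bsub>P\<^esub> iotaP r'"
    using H(2) by (simp only: triangular_def)
  also have "\<dots> = monom P (iota (c' * c)) 1 \<oplus>\<^bsub>P\<^esub> iotaP (c' * r + r')"
    by (simp only: P.r_distr const_mult_monom iota_mult iota_add P.a_assoc monom_add
        monom_closed iota_closed R.m_closed)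
  finally show ?thesis using H(2) H' g' by (simp add: triangular_def mult.commute)
qed

lemma triangular_identity:
  assumes "H \<in> ring_hom P P" "triangular H g 1 0" "\<And>a. a \<in> carrier R \<Longrightarrow> g a = a" "p \<in> carrier P"
  shows "H p = p"
proof -
  have "(\<lambda>p. p) \<in> ring_hom P P" by (auto intro: ring_hom_memI)
  from hom_eqI[OF assms(1) this P.ring_axioms _ _ assms(4)] show ?thesis
    using assms(2,3) by (simp add: triangular_def iota_one)
qed

lemma triangular_aut_exists:
  assumes g: "g \<in> alg_aut R iota" and c: "c \<noteq> 0"
  shows "\<exists>H\<in>alg_aut P iotaP. triangular H g c r"
proof -
  define g' where "g' = inv_into (carrier R) g"
  have g': "g' \<in> alg_aut R iota" unfolding g'_def by (rule alg_aut_inverse[OF g])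
  note gD = alg_autD[OF g] and g'D = alg_autD[OF g']
  note g_closed = ring_hom_closed[OF gD(2)] and g'_closed = ring_hom_closed[OF g'D(2)]
  obtain H where H: "H \<in> ring_hom P P" "triangular H g c r"
    using triangular_hom_exists[OF gD(2)] by blast
  obtain H' where H': "H' \<in> ring_hom P P" "triangular H' g' (inverse c) (- (inverse c * r))"
    using triangular_hom_exists[OF g'D(2)] by blast
  have "triangular (H \<circ> H') (g \<circ> g') 1 0" "triangular (H' \<circ> H) (g' \<circ> g) 1 0"
    using triangular_comp[OF H H'(2) gD(4) g'_closed] triangular_comp[OF H' H(2) g'D(4) g_closed] c
    by (simp_all flip: mult.assoc)
  then have inverse: "H (H' p) = p" "H' (H p) = p" if "p \<in> carrier P" for p
    using triangular_identity[OF ring_hom_trans[OF H'(1) H(1)] _ _ that]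
      triangular_identity[OF ring_hom_trans[OF H(1) H'(1)] _ _ that]
      ring_iso_inv_into[OF gD(1)] unfolding g'_def by auto
  have "bij_betw H (carrier P) (carrier P)"
    by (rule bij_betw_byWitness[of _ H'])
      (use inverse ring_hom_closed[OF H(1)] ring_hom_closed[OF H'(1)] in auto)
  moreover have "H (iotaP d) = iotaP d" for d
    using H(2) gD(4) by (simp add: triangular_def)
  ultimately have "H \<in> alg_aut P iotaP"
    using H(1) by (intro P.alg_autI) (simp_all add: ring_iso_def)
  with H(2) show ?thesis by blast
qed

end

section \<open>Rigid algebras\<close>

locale rigid_algebra = noncomm_domain R + scalar_algebra R iota
  for R :: "('a, 'm) ring_scheme" (structure) and iota :: "'k::field \<Rightarrow> 'a" +
  assumes same_twist_proportional: "same_twist R u v \<Longrightarrow> v \<noteq> \<zero> \<Longrightarrow> \<exists>c. u = iota c \<otimes> v"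
    and normal_generate: "subring S R \<Longrightarrow> (\<And>c. iota c \<in> S) \<Longrightarrow> factor_closed R S \<Longrightarrow>
      (\<And>z. normal_elem R z \<Longrightarrow> z \<noteq> \<zero> \<Longrightarrow> z \<in> S) \<Longrightarrow> carrier R \<subseteq> S"

lemma (in UP_scalar_algebra) normal_elem_const:
  assumes z: "normal_elem R z"
  shows "normal_elem P (const z)"
  unfolding normal_elem_def
proof (intro conjI subsetI)
  note z_closed = normal_elemD(1)[OF z]
  then show zP: "const z \<in> carrier P" by simp
  have "const a \<in> normalized_by P (const z)" if a: "a \<in> carrier R" for a
  proof -
    obtain b where "b \<in> carrier R" "z \<otimes> a = b \<otimes> z" using normal_elemD(2)[OF z a] by blast
    then show ?thesis using a z_closed const_mult_monom
      unfolding normalized_by_def by (auto intro!: bexI[of _ "const b"])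
  qed
  moreover have "indet \<in> normalized_by P (const z)"
    using indet_central zP unfolding normalized_by_def ring_center_def
    by (auto intro!: bexI[of _ indet])
  ultimately show "p \<in> normalized_by P (const z)" if "p \<in> carrier P" for p
    using subring_containsI[OF P.normalized_by_subring[OF zP] _ that] that by simp
qed

locale UP_rigid_algebra = UP_scalar_algebra R P iota + rigid_algebra R iota
  for R :: "('a, 'm) ring_scheme" (structure) and P (structure) and iota :: "'k::field \<Rightarrow> 'a"

sublocale UP_rigid_algebra \<subseteq> UP_noncomm_domain R P
  by unfold_locales

context UP_rigid_algebra
begin

lemma center_coeffs_scalar:
  assumes p: "p \<in> ring_center P"
  shows "coeff P p n \<in> range iota"
proof -
  have p': "p \<in> carrier P" "\<And>q. q \<in> carrier P \<Longrightarrow> p \<otimes>\<^bsub>P\<^esub> q = q \<otimes>\<^bsub>P\<^esub> p"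
    using p by (auto simp: ring_center_def)
  have "coeff P p n \<otimes> a = a \<otimes> coeff P p n" if "a \<in> carrier R" for a
    using p' that coeff_mult_const coeff_const_mult by (metis monom_closed)
  then have "same_twist R (coeff P p n) \<one>" using p'(1) by (auto simp: same_twist_def)
  then show ?thesis using same_twist_proportional one_not_zero by fastforce
qed

lemma central_const:
  assumes "p \<in> ring_center P" "deg R p = 0"
  obtains c where "p = iotaP c"
proof -
  have "p = const (coeff P p 0)" using deg_zero_impl_monom assms by (auto simp: ring_center_def)
  then show thesis using center_coeffs_scalar[OF assms(1), of 0] that by auto
qed

lemma normalizing_const_factorization:
  assumes u: "u \<in> carrier P" "u \<noteq> \<zero>\<^bsub>P\<^esub>"
    and normalizes: "\<And>a. a \<in> carrier R \<Longrightarrow> \<exists>b\<in>carrier P. u \<otimes>\<^bsub>P\<^esub> const a = b \<otimes>\<^bsub>P\<^esub> u"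
  obtains f w where "f \<in> ring_center P" "w \<in> carrier R" "u = f \<otimes>\<^bsub>P\<^esub> const w"
proof -
  define w where "w = coeff P u (deg R u)"
  have w: "w \<in> carrier R" "w \<noteq> \<zero>" using u lcoeff_nonzero2 by (auto simp: w_def)
  have "\<exists>c. coeff P u k = iota c \<otimes> w" for k
    using same_twist_proportional[OF same_twist_coeffs[OF u normalizes]] w(2) unfolding w_def
    by blast
  then obtain c where c: "\<And>k. coeff P u k = iota (c k) \<otimes> w" by metis
  define f where "f k = (if k \<le> deg R u then iota (c k) else \<zero>)" for k
  obtain f' where f': "f' \<in> carrier P" "\<And>k. coeff P f' k = f k"
    by (rule poly_with_coeffs_exists[of f "deg R u"]) (auto simp: f_def)
  have "f k \<in> range iota" for k
    unfolding f_def by (metis iota_zero rangeI)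
  then have "f' \<in> ring_center P" using f' by (intro scalar_coeffs_central) auto
  moreover have "coeff P u k = f k \<otimes> w" for k
    using c w deg_aboveD[OF _ u(1), of k] by (simp add: f_def)
  then have "u = f' \<otimes>\<^bsub>P\<^esub> const w"
    using u f' w by (intro up_eqI) (simp_all only: coeff_mult_const monom_closed P.m_closed)
  ultimately show thesis using w that by blast
qed

lemma deg_0_if_normal_deg_0:
  assumes \<phi>: "\<phi> \<in> ring_hom R P" and inj: "\<And>a. a \<in> carrier R \<Longrightarrow> \<phi> a = \<zero>\<^bsub>P\<^esub> \<Longrightarrow> a = \<zero>"
    and scalars: "\<And>c. \<phi> (iota c) = iotaP c"
    and normal: "\<And>z. normal_elem R z \<Longrightarrow> z \<noteq> \<zero> \<Longrightarrow> deg R (\<phi> z) = 0"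
    and a: "a \<in> carrier R"
  shows "deg R (\<phi> a) = 0"
proof -
  define S where "S = {a \<in> carrier R. deg R (\<phi> a) = 0}"
  note \<phi>_closed = ring_hom_closed[OF \<phi>]
  have "carrier R \<subseteq> S"
  proof (rule normal_generate)
    show "subring S R"
    proof (rule subring_scalarsI)
      fix a b assume "a \<in> S" "b \<in> S"
      then have ab: "a \<in> carrier R" "b \<in> carrier R" "deg R (\<phi> a) = 0" "deg R (\<phi> b) = 0"
        by (auto simp: S_def)
      then show "a \<oplus> b \<in> S"
        using deg_add[OF \<phi>_closed \<phi>_closed, of a b] by (simp add: S_def ring_hom_add[OF \<phi>])
      show "a \<otimes> b \<in> S"
        using ab deg_mult_ring[OF \<phi>_closed \<phi>_closed, of a b]
        by (simp add: S_def ring_hom_mult[OF \<phi>])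
    qed (auto simp: S_def scalars)
    show "factor_closed R S"
      unfolding factor_closed_def
    proof (intro ballI impI)
      fix a b assume ab: "a \<in> carrier R" "b \<in> carrier R" "a \<otimes> b \<in> S" "a \<otimes> b \<noteq> \<zero>"
      then have "deg R (\<phi> a) + deg R (\<phi> b) = 0"
        using deg_factors[OF \<phi>_closed \<phi>_closed, of a b] inj[of "a \<otimes> b"]
        by (auto simp: S_def ring_hom_mult[OF \<phi>])
      then show "a \<in> S \<and> b \<in> S" using ab by (simp add: S_def)
    qed
  qed (use normal in \<open>auto simp: S_def scalars normal_elem_def\<close>)
  with a show ?thesis by (auto simp: S_def)
qed

section \<open>Automorphisms of polynomial algebras over rigid algebras\<close>

lemma alg_aut_normal_deg_0:
  assumes h: "h \<in> alg_aut P iotaP" and z: "normal_elem R z" "z \<noteq> \<zero>"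
  shows "deg R (h (const z)) = 0"
proof -
  let ?h' = "inv_into (carrier P) h"
  note hD = P.alg_autD[OF h] and h'D = P.alg_autD[OF P.alg_aut_inverse[OF h]]
  note inverse = ring_iso_inv_into[OF hD(1)]
  have zP: "const z \<in> carrier P" "const z \<noteq> \<zero>\<^bsub>P\<^esub>"
    using z const_eq_zero_iff by (auto simp: normal_elem_def)
  define u where "u = h (const z)"
  have normal: "normal_elem P u"
    unfolding u_def by (rule ring_iso_normal_elem[OF hD(1) normal_elem_const[OF z(1)]])
  then have u: "u \<in> carrier P" by (simp add: normal_elem_def)
  have "?h' u = const z" unfolding u_def by (rule inverse(1)[OF zP(1)])
  then have "u \<noteq> \<zero>\<^bsub>P\<^esub>"
    using zP(2) ring_hom_zero[OF h'D(2) P.ring_axioms P.ring_axioms] by auto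
  with u normal obtain f w where f: "f \<in> ring_center P" and w: "w \<in> carrier R"
    and u_eq: "u = f \<otimes>\<^bsub>P\<^esub> const w"
    using normalizing_const_factorization[of u] normal_elemD(2)[of P u]
    by (metis monom_closed)
  have fP: "f \<in> carrier P" using f by (simp add: ring_center_def)
  have z_factors: "const z = ?h' f \<otimes>\<^bsub>P\<^esub> ?h' (const w)"
    using \<open>?h' u = const z\<close> u_eq w fP by (simp add: ring_hom_mult[OF h'D(2)])
  have "deg R (?h' f) + deg R (?h' (const w)) = deg R (const z)"
    unfolding z_factors using ring_hom_closed[OF h'D(2)] w fP zP(2)
    by (intro deg_factors) (simp_all flip: z_factors)
  then have "deg R (?h' f) = 0" using z(1) by (simp add: normal_elem_def)
  then obtain c where "?h' f = iotaP c" by (rule central_const[OF ring_iso_center[OF h'D(1) f]])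
  then have "f = iotaP c" using inverse(2)[OF fP] hD(4) by metis
  then show ?thesis
    using u_eq w const_mult_monom[of "iota c" w 0] unfolding u_def[symmetric] by simp
qed

lemma alg_aut_const_deg_0:
  assumes h: "h \<in> alg_aut P iotaP" and a: "a \<in> carrier R"
  shows "deg R (h (const a)) = 0"
proof -
  note hD = P.alg_autD[OF h]
  have "(\<lambda>a. h (const a)) \<in> ring_hom R P"
    using ring_hom_trans[OF const_ring_hom hD(2)] by (simp add: comp_def)
  moreover have "a = \<zero>" if "a \<in> carrier R" "h (const a) = \<zero>\<^bsub>P\<^esub>" for a
  proof -
    have "h (const a) = h (const \<zero>)"
      using that ring_hom_zero[OF hD(2) P.ring_axioms P.ring_axioms] by simp
    then show ?thesis
      using that(1) hD(3) const_eq_iff[of a \<zero>] unfolding bij_betw_def inj_on_def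
      by (metis R.zero_closed monom_closed)
  qed
  ultimately show ?thesis
    using hD(4) alg_aut_normal_deg_0[OF h] a by (rule deg_0_if_normal_deg_0)
qed

definition const_part :: "((nat \<Rightarrow> 'a) \<Rightarrow> nat \<Rightarrow> 'a) \<Rightarrow> 'a \<Rightarrow> 'a" where
  "const_part h a = coeff P (h (const a)) 0"

lemma const_part_closed: "h \<in> alg_aut P iotaP \<Longrightarrow> a \<in> carrier R \<Longrightarrow> const_part h a \<in> carrier R"
  using ring_hom_closed[OF P.alg_autD(2)] by (simp add: const_part_def)

lemma alg_aut_const:
  "h \<in> alg_aut P iotaP \<Longrightarrow> a \<in> carrier R \<Longrightarrow> h (const a) = const (const_part h a)"
  unfolding const_part_def
  using alg_aut_const_deg_0 deg_zero_impl_monom ring_hom_closed[OF P.alg_autD(2)] by simp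

lemma const_part_inverse:
  assumes h: "h \<in> alg_aut P iotaP" and a: "a \<in> carrier R"
  shows "const_part (inv_into (carrier P) h) (const_part h a) = a"
    and "const_part h (const_part (inv_into (carrier P) h) a) = a"
proof -
  let ?h' = "inv_into (carrier P) h"
  note h' = P.alg_aut_inverse[OF h] and inverse = ring_iso_inv_into[OF P.alg_autD(1)[OF h]]
  have "const (const_part ?h' (const_part h a)) = const a"
    using inverse(1)[of "const a"] a const_part_closed[OF h] alg_aut_const[OF h]
      alg_aut_const[OF h']
    by simp
  moreover have "const (const_part h (const_part ?h' a)) = const a"
    using inverse(2)[of "const a"] a const_part_closed[OF h'] alg_aut_const[OF h]
      alg_aut_const[OF h']
    by simp
  ultimately show "const_part ?h' (const_part h a) = a" "const_part h (const_part ?h' a) = a"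
    using a const_part_closed[OF h] const_part_closed[OF h'] const_eq_iff by blast+
qed

lemma const_part_alg_aut:
  assumes h: "h \<in> alg_aut P iotaP"
  shows "const_part h \<in> alg_aut R iota"
proof (rule alg_autI)
  note hD = P.alg_autD[OF h] and h_closed = ring_hom_closed[OF P.alg_autD(2)[OF h]]
  have "const_part h \<in> ring_hom R R"
  proof (rule ring_hom_memI)
    fix a b assume ab: "a \<in> carrier R" "b \<in> carrier R"
    have "h (const (a \<oplus> b)) = h (const a) \<oplus>\<^bsub>P\<^esub> h (const b)"
      using ab by (simp add: ring_hom_add[OF hD(2)])
    then show "const_part h (a \<oplus> b) = const_part h a \<oplus> const_part h b"
      using ab by (simp add: const_part_def h_closed)
    have "h (const (a \<otimes> b)) = h (const a) \<otimes>\<^bsub>P\<^esub> h (const b)"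
      using ab by (simp add: ring_hom_mult[OF hD(2)] flip: const_mult_monom)
    then show "const_part h (a \<otimes> b) = const_part h a \<otimes> const_part h b"
      using ab by (simp add: const_part_def h_closed)
  qed (use const_part_closed[OF h] hD(4)[of 1] in \<open>simp_all add: const_part_def iota_one\<close>)
  moreover have "bij_betw (const_part h) (carrier R) (carrier R)"
    by (rule bij_betw_byWitness[of _ "const_part (inv_into (carrier P) h)"])
      (use const_part_inverse[OF h] const_part_closed[OF h]
        const_part_closed[OF P.alg_aut_inverse[OF h]] in auto)
  ultimately show "const_part h \<in> ring_iso R R" by (simp add: ring_iso_def)
  show "const_part h (iota c) = iota c" for c using hD(4)[of c] by (simp add: const_part_def)
qed

lemma alg_aut_indet_deg_pos:
  assumes h: "h \<in> alg_aut P iotaP"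
  shows "deg R (h indet) > 0"
proof (rule ccontr)
  note h_closed = ring_hom_closed[OF P.alg_autD(2)[OF h]]
  assume "\<not> deg R (h indet) > 0"
  then obtain a where a: "a \<in> carrier R" "h indet = const a"
    using deg_eq_0_iff_const[OF h_closed[of indet]] by auto
  have "indet = inv_into (carrier P) h (const a)"
    using ring_iso_inv_into(1)[OF P.alg_autD(1)[OF h], of indet] a by simp
  then show False
    using alg_aut_const[OF P.alg_aut_inverse[OF h] a(1)]
      indet_neq_const[OF const_part_closed[OF P.alg_aut_inverse[OF h] a(1)]] by simp
qed

text \<open>If \<open>h t - r = t f\<close>, then \<open>t - r = h\<inverse> t \<cdot> h\<inverse> f\<close> has degree \<open>1\<close> and \<open>h\<inverse> t\<close> is not constant, so
  \<open>f\<close> is a constant.\<close>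

lemma alg_aut_indet_linear:
  assumes h: "h \<in> alg_aut P iotaP"
  obtains c r where "h indet = monom P (iota c) 1 \<oplus>\<^bsub>P\<^esub> iotaP r"
proof -
  let ?h' = "inv_into (carrier P) h"
  note h' = P.alg_aut_inverse[OF h]
  note hD = P.alg_autD[OF h] and h'D = P.alg_autD[OF h']
  note inverse = ring_iso_inv_into[OF hD(1)] and h'_closed = ring_hom_closed[OF h'D(2)]
  have t: "indet \<in> carrier P" and ht: "h indet \<in> carrier P"
    using ring_hom_closed[OF hD(2)] by simp_all
  have scalar: "coeff P (h indet) n \<in> range iota" for n
    by (rule center_coeffs_scalar[OF ring_iso_center[OF hD(1) indet_central]])
  obtain r where r: "coeff P (h indet) 0 = iota r" using scalar[of 0] by blast
  obtain c where c: "coeff P (h indet) 1 = iota c" using scalar[of 1] by blast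
  have "coeff P (h indet \<ominus>\<^bsub>P\<^esub> iotaP r) 0 = \<zero>"
    using ht r by (simp add: R.r_right_minus_eq)
  then obtain f where f: "f \<in> carrier P" "h indet \<ominus>\<^bsub>P\<^esub> iotaP r = indet \<otimes>\<^bsub>P\<^esub> f"
    using ht by (elim indet_dvd[rotated]) simp_all
  have "indet \<ominus>\<^bsub>P\<^esub> iotaP r = ?h' (h indet \<ominus>\<^bsub>P\<^esub> iotaP r)"
    using ht inverse(1)[OF t] h'D(4)[of "- r"]
    by (simp add: a_minus_def ring_hom_add[OF h'D(2)] iota_minus)
  then have linear: "indet \<ominus>\<^bsub>P\<^esub> iotaP r = ?h' indet \<otimes>\<^bsub>P\<^esub> ?h' f"
    using f by (simp add: ring_hom_mult[OF h'D(2)])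
  have "coeff P (indet \<ominus>\<^bsub>P\<^esub> iotaP r) 1 = \<one>" by (simp add: a_minus_def)
  then have "indet \<ominus>\<^bsub>P\<^esub> iotaP r \<noteq> \<zero>\<^bsub>P\<^esub>" using one_not_zero coeff_zero[of 1] by metis
  moreover have "deg R (indet \<ominus>\<^bsub>P\<^esub> iotaP r) \<le> 1" by (rule deg_aboveI) (auto simp: a_minus_def)
  ultimately have "deg R (?h' indet) + deg R (?h' f) \<le> 1"
    unfolding linear using deg_factors[of "?h' indet" "?h' f"] h'_closed t f(1) by simp
  then have "deg R (?h' f) = 0" using alg_aut_indet_deg_pos[OF h'] by simp
  then obtain b where "b \<in> carrier R" "?h' f = const b"
    using deg_eq_0_iff_const[OF h'_closed[OF f(1)]] by auto
  then obtain b' where b': "b' \<in> carrier R" "f = const b'"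
    using inverse(2)[OF f(1)] alg_aut_const[OF h] const_part_closed[OF h] by metis
  have "h indet = indet \<otimes>\<^bsub>P\<^esub> f \<oplus>\<^bsub>P\<^esub> iotaP r"
    using f(2) ht by (metis P.add.inv_solve_right P.iota_closed P.minus_eq P.m_closed f(1) t)
  also have "indet \<otimes>\<^bsub>P\<^esub> f = monom P b' 1" using b' monom_mult_const[of \<one> b' 1] by simp
  finally have "h indet = monom P b' 1 \<oplus>\<^bsub>P\<^esub> iotaP r" .
  moreover from this have "b' = iota c" using c b' by simp
  ultimately show thesis using that by blast
qed

lemma alg_aut_triangular:
  assumes h: "h \<in> alg_aut P iotaP"
  shows "\<exists>g\<in>alg_aut R iota. \<exists>c r. c \<noteq> 0 \<and> triangular h g c r"
proof -
  obtain c r where cr: "h indet = monom P (iota c) 1 \<oplus>\<^bsub>P\<^esub> iotaP r"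
    by (rule alg_aut_indet_linear[OF h])
  have "c \<noteq> 0" using alg_aut_indet_deg_pos[OF h] cr by auto
  with cr show ?thesis
    using const_part_alg_aut[OF h] alg_aut_const[OF h] unfolding triangular_def by blast
qed

end

section \<open>Locally nilpotent derivations\<close>

lemma (in scalar_algebra) finsum_complementary_weights:
  assumes G: "\<And>i. G i \<in> carrier R"
  shows "(\<Oplus>i\<in>{..m}. iota (of_nat (Suc i)) \<otimes> G (Suc i) \<oplus> iota (of_nat (Suc m - i)) \<otimes> G i)
    = iota (of_nat (Suc m)) \<otimes> (\<Oplus>i\<in>{..Suc m}. G i)"
proof -
  have shift: "(\<Oplus>i\<in>{..m}. iota (of_nat (Suc i)) \<otimes> G (Suc i))
      = (\<Oplus>i\<in>{..Suc m}. iota (of_nat i) \<otimes> G i)"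
    using G by (subst finsum_Suc2) auto
  have extend: "(\<Oplus>i\<in>{..m}. iota (of_nat (Suc m - i)) \<otimes> G i)
      = (\<Oplus>i\<in>{..Suc m}. iota (of_nat (Suc m - i)) \<otimes> G i)"
    using G by (subst finsum_Suc) auto
  have "(\<Oplus>i\<in>{..m}. iota (of_nat (Suc i)) \<otimes> G (Suc i) \<oplus> iota (of_nat (Suc m - i)) \<otimes> G i)
      = (\<Oplus>i\<in>{..Suc m}. iota (of_nat i) \<otimes> G i \<oplus> iota (of_nat (Suc m - i)) \<otimes> G i)"
    by (subst (1 2) finsum_addf) (auto simp only: shift extend intro!: m_closed iota_closed G)
  also have "\<dots> = (\<Oplus>i\<in>{..Suc m}. iota (of_nat (Suc m)) \<otimes> G i)"
  proof (rule finsum_cong')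
    fix i assume "i \<in> {..Suc m}"
    then have "(of_nat (Suc m) :: 'k) = of_nat i + of_nat (Suc m - i)"
      by (simp flip: of_nat_add)
    then show "iota (of_nat i) \<otimes> G i \<oplus> iota (of_nat (Suc m - i)) \<otimes> G i
        = iota (of_nat (Suc m)) \<otimes> G i"
      by (simp only: iota_add l_distr iota_closed G)
  qed (use G in auto)
  also have "\<dots> = iota (of_nat (Suc m)) \<otimes> (\<Oplus>i\<in>{..Suc m}. G i)"
    using G by (intro finsum_rdistr[symmetric]) auto
  finally show ?thesis .
qed

locale locally_nilpotent_derivation = scalar_algebra R iota
  for R :: "('a, 'm) ring_scheme" (structure) and iota :: "'k::field \<Rightarrow> 'a" +
  fixes d :: "'a \<Rightarrow> 'a"
  assumes char_0: "CHAR('k) = 0"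
    and derivation: "alg_derivation R iota d"
    and nilpotent: "locally_nilpotent R d"
begin

lemma of_nat_neq_0: "m > 0 \<Longrightarrow> (of_nat m :: 'k) \<noteq> 0"
  using char_0 by (simp add: of_nat_eq_0_iff_char_dvd)

lemma derivation_closed [simp]: "a \<in> carrier R \<Longrightarrow> d a \<in> carrier R"
  and derivation_add: "a \<in> carrier R \<Longrightarrow> b \<in> carrier R \<Longrightarrow> d (a \<oplus> b) = d a \<oplus> d b"
  and derivation_mult: "a \<in> carrier R \<Longrightarrow> b \<in> carrier R \<Longrightarrow> d (a \<otimes> b) = d a \<otimes> b \<oplus> a \<otimes> d b"
  and derivation_scale: "a \<in> carrier R \<Longrightarrow> d (iota c \<otimes> a) = iota c \<otimes> d a"
  using derivation unfolding alg_derivation_def by blast+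

lemma derivation_zero: "d \<zero> = \<zero>"
  using derivation_scale[of \<zero> 0] by simp

lemma derivation_iota: "d (iota c) = \<zero>"
proof -
  have "d \<one> = d \<one> \<oplus> d \<one>" using derivation_mult[of \<one> \<one>] by simp
  then have "d \<one> = \<zero>" using add.l_cancel_one'[of "d \<one>" "d \<one>"] by simp
  then show ?thesis using derivation_scale[of \<one> c] by simp
qed

lemma derivation_funpow_closed [simp]: "a \<in> carrier R \<Longrightarrow> (d ^^ k) a \<in> carrier R"
  by (induction k) simp_all

lemma derivation_funpow_add:
  "a \<in> carrier R \<Longrightarrow> b \<in> carrier R \<Longrightarrow> (d ^^ k) (a \<oplus> b) = (d ^^ k) a \<oplus> (d ^^ k) b"
  by (induction k) (simp_all add: derivation_add)

lemma derivation_funpow_scale: "a \<in> carrier R \<Longrightarrow> (d ^^ k) (iota c \<otimes> a) = iota c \<otimes> (d ^^ k) a"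
  by (induction k) (simp_all add: derivation_scale)

lemma derivation_funpow_eq_0_mono: "(d ^^ k) a = \<zero> \<Longrightarrow> j \<ge> k \<Longrightarrow> (d ^^ j) a = \<zero>"
  by (induction j) (auto simp: le_Suc_eq derivation_zero)

lemma derivation_finsum:
  assumes "\<And>i. f i \<in> carrier R"
  shows "d (\<Oplus>i\<in>{..k::nat}. f i) = (\<Oplus>i\<in>{..k}. d (f i))"
  using assms by (induction k) (simp_all add: derivation_add Pi_def)

lemma derivation_eigenvector_eq_0:
  assumes z: "z \<in> carrier R" and eigen: "d z = iota c \<otimes> z"
  shows "d z = \<zero>"
proof (cases "c = 0")
  case False
  have pow: "(d ^^ k) z = iota (c ^ k) \<otimes> z" for k
  proof (induction k)
    case (Suc k)
    have "iota (c ^ k) \<otimes> (iota c \<otimes> z) = iota (c ^ Suc k) \<otimes> z"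
      unfolding power_Suc2 using z by (simp add: iota_mult m_assoc)
    then show ?case using Suc z eigen by (simp add: derivation_scale)
  qed (use z in \<open>simp add: iota_one\<close>)
  obtain k where "(d ^^ k) z = \<zero>" using nilpotent z unfolding locally_nilpotent_def by blast
  then have "z = \<zero>" using iota_mult_cancel[of "c ^ k" z \<zero>] z False by (simp add: pow)
  then show ?thesis by (simp add: derivation_zero)
qed (use z eigen in simp)

definition divided_power :: "nat \<Rightarrow> 'a \<Rightarrow> 'a" where
  "divided_power j a = iota (inverse (of_nat (fact j))) \<otimes> (d ^^ j) a"

lemma divided_power_closed [simp]: "a \<in> carrier R \<Longrightarrow> divided_power j a \<in> carrier R"
  by (simp add: divided_power_def)

lemma divided_power_0 [simp]: "a \<in> carrier R \<Longrightarrow> divided_power 0 a = a"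
  by (simp add: divided_power_def iota_one)

lemma divided_power_1: "a \<in> carrier R \<Longrightarrow> divided_power 1 a = d a"
  by (simp add: divided_power_def iota_one)

lemma divided_power_Suc:
  assumes a: "a \<in> carrier R"
  shows "iota (of_nat (Suc j)) \<otimes> divided_power (Suc j) a = d (divided_power j a)"
proof -
  have "(of_nat (Suc j) :: 'k) * inverse (of_nat (fact (Suc j))) = inverse (of_nat (fact j))"
    using of_nat_neq_0[of "Suc j"] by (simp only: fact_Suc of_nat_mult inverse_mult_distrib) simp
  then have "iota (inverse (of_nat (fact j)))
      = iota (of_nat (Suc j)) \<otimes> iota (inverse (of_nat (fact (Suc j))))"
    by (simp only: iota_mult[symmetric])
  then have "iota (of_nat (Suc j)) \<otimes> divided_power (Suc j) a
      = iota (inverse (of_nat (fact j))) \<otimes> (d ^^ Suc j) a"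
    unfolding divided_power_def using a by (simp only: m_assoc iota_closed derivation_funpow_closed)
  then show ?thesis using a by (simp add: divided_power_def derivation_scale)
qed

lemma divided_power_eq_0: "(d ^^ k) a = \<zero> \<Longrightarrow> j \<ge> k \<Longrightarrow> divided_power j a = \<zero>"
  using derivation_funpow_eq_0_mono[of k a j] by (simp add: divided_power_def)

lemma divided_power_add:
  "a \<in> carrier R \<Longrightarrow> b \<in> carrier R \<Longrightarrow>
    divided_power j (a \<oplus> b) = divided_power j a \<oplus> divided_power j b"
  by (simp add: divided_power_def derivation_funpow_add r_distr)

lemma divided_power_iota: "divided_power j (iota c) = (if j = 0 then iota c else \<zero>)"
  using divided_power_eq_0[of 1 "iota c" j] derivation_iota by auto

text \<open>Both sides have the same product with \<open>m + 1\<close>: the term of index \<open>i\<close> on the right arises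
  \<open>i\<close> times from differentiating the first factor and \<open>m + 1 - i\<close> times from the second.\<close>

lemma divided_power_mult:
  assumes a: "a \<in> carrier R" and b: "b \<in> carrier R"
  shows "divided_power m (a \<otimes> b) = (\<Oplus>i\<in>{..m}. divided_power i a \<otimes> divided_power (m - i) b)"
proof (induction m)
  case 0
  then show ?case using a b by simp
next
  case (Suc m)
  define G where "G i = divided_power i a \<otimes> divided_power (Suc m - i) b" for i
  have G: "G i \<in> carrier R" for i using a b by (simp add: G_def)
  have "iota (of_nat (Suc m)) \<otimes> divided_power (Suc m) (a \<otimes> b)
      = (\<Oplus>i\<in>{..m}. d (divided_power i a \<otimes> divided_power (m - i) b))"
    using a b by (simp only: divided_power_Suc m_closed Suc) (rule derivation_finsum, simp)
  also have "\<dots> = (\<Oplus>i\<in>{..m}. iota (of_nat (Suc i)) \<otimes> G (Suc i)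
      \<oplus> iota (of_nat (Suc m - i)) \<otimes> G i)"
  proof (rule finsum_cong')
    fix i assume "i \<in> {..m}"
    then have i: "Suc m - i = Suc (m - i)" by auto
    show "d (divided_power i a \<otimes> divided_power (m - i) b)
        = iota (of_nat (Suc i)) \<otimes> G (Suc i) \<oplus> iota (of_nat (Suc m - i)) \<otimes> G i"
      using a b unfolding G_def i
      by (simp only: derivation_mult divided_power_closed divided_power_Suc[symmetric]
          iota_left_commute m_assoc iota_closed diff_Suc_Suc)
  qed (use G in auto)
  also have "\<dots> = iota (of_nat (Suc m)) \<otimes> (\<Oplus>i\<in>{..Suc m}. G i)"
    by (rule finsum_complementary_weights[OF G])
  finally show ?case
    unfolding G_def using a b of_nat_neq_0[of "Suc m"]
    by (elim iota_mult_cancel[rotated -1]) (auto intro!: finsum_closed)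
qed

end

locale UP_locally_nilpotent_derivation =
  UP_scalar_algebra R P iota + locally_nilpotent_derivation R iota d
  for R :: "('a, 'm) ring_scheme" (structure) and P (structure)
    and iota :: "'k::field \<Rightarrow> 'a" and d
begin

definition exp_poly :: "'a \<Rightarrow> nat \<Rightarrow> 'a" where "exp_poly a = (\<lambda>j. divided_power j a)"

lemma
  assumes a: "a \<in> carrier R"
  shows exp_poly_closed [simp]: "exp_poly a \<in> carrier P"
    and coeff_exp_poly [simp]: "coeff P (exp_poly a) j = divided_power j a"
proof -
  obtain k where "(d ^^ k) a = \<zero>" using nilpotent a unfolding locally_nilpotent_def by blast
  then have "exp_poly a \<in> up R"
    using divided_power_eq_0 a unfolding exp_poly_def
    by (intro mem_upI exI[of _ k] bound.intro) auto
  then show "exp_poly a \<in> carrier P" "coeff P (exp_poly a) j = divided_power j a"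
    by (simp_all add: P_def UP_def exp_poly_def)
qed

lemma exp_poly_iota: "exp_poly (iota c) = iotaP c"
  by (rule up_eqI) (auto simp: divided_power_iota)

lemma exp_poly_hom: "exp_poly \<in> ring_hom R P"
proof (rule ring_hom_memI)
  fix a b assume ab: "a \<in> carrier R" "b \<in> carrier R"
  show "exp_poly (a \<oplus> b) = exp_poly a \<oplus>\<^bsub>P\<^esub> exp_poly b"
    using ab by (intro up_eqI) (simp_all add: divided_power_add)
  show "exp_poly (a \<otimes> b) = exp_poly a \<otimes>\<^bsub>P\<^esub> exp_poly b"
    using ab by (intro up_eqI) (simp_all add: divided_power_mult)
qed (use exp_poly_iota[of 1] in \<open>simp_all add: iota_one\<close>)

lemma exp_poly_eq_0: "a \<in> carrier R \<Longrightarrow> exp_poly a = \<zero>\<^bsub>P\<^esub> \<Longrightarrow> a = \<zero>"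
  by (metis coeff_exp_poly coeff_zero divided_power_0)

end

sublocale UP_locally_nilpotent_derivation \<subseteq> exp: UP_eval_commuting R P P exp_poly indet
  using exp_poly_hom indet_central by unfold_locales (auto simp: ring_center_def)

context UP_locally_nilpotent_derivation
begin

lemma exp_range:
  "subring (exp.ev ` carrier P) P" "indet \<in> exp.ev ` carrier P"
  "a \<in> carrier R \<Longrightarrow> exp_poly a \<in> exp.ev ` carrier P"
proof -
  interpret E: ring_hom_ring P P exp.ev
    using P.ring_axioms exp.eval_hom by (simp add: ring_hom_ring_def ring_hom_ring_axioms_def)
  show "subring (exp.ev ` carrier P) P" by (rule E.img_is_subring[OF P.carrier_is_subring])
  show "indet \<in> exp.ev ` carrier P"
    using exp.eval_indet by (intro image_eqI[of _ _ indet]) simp_all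
  show "exp_poly a \<in> exp.ev ` carrier P" if "a \<in> carrier R"
    using exp.eval_const[OF that] that by (intro image_eqI[of _ _ "const a"]) simp_all
qed

text \<open>We have \<open>a = exp (t d) a - t q\<close>, where \<open>d\<close> has smaller nilpotency index on the coefficients
  of \<open>q\<close> than on \<open>a\<close>.\<close>

lemma const_in_range_exp:
  assumes "a \<in> carrier R" "(d ^^ k) a = \<zero>"
  shows "const a \<in> exp.ev ` carrier P"
  using assms
proof (induction k arbitrary: a)
  case 0
  then have "const a = exp.ev \<zero>\<^bsub>P\<^esub>"
    using exp.eval_const[of \<zero>] exp_poly_iota[of 0] by simp
  then show ?case by blast
next
  case (Suc k)
  let ?S = "exp.ev ` carrier P"
  note S = exp_range(1) and indet_S = exp_range(2) and exp_S = exp_range(3)[OF Suc.prems(1)]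
  have "exp_poly a \<ominus>\<^bsub>P\<^esub> const a \<in> carrier P" "coeff P (exp_poly a \<ominus>\<^bsub>P\<^esub> const a) 0 = \<zero>"
    using Suc.prems(1) by (simp_all add: R.r_right_minus_eq)
  then obtain q where q: "q \<in> carrier P" "exp_poly a \<ominus>\<^bsub>P\<^esub> const a = indet \<otimes>\<^bsub>P\<^esub> q"
    "\<And>n. coeff P q n = coeff P (exp_poly a \<ominus>\<^bsub>P\<^esub> const a) (Suc n)"
    by (rule indet_dvd) blast
  have "const (coeff P q n) \<in> ?S" for n
  proof (rule Suc.IH)
    have "(d ^^ k) ((d ^^ Suc n) a) = \<zero>"
      using derivation_funpow_eq_0_mono[OF Suc.prems(2), of "k + Suc n"]
      by (simp only: funpow_add o_apply)
    then show "(d ^^ k) (coeff P q n) = \<zero>"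
      using q(3) Suc.prems(1) derivation_funpow_scale[of "(d ^^ Suc n) a" k]
      by (simp add: divided_power_def R.minus_eq)
  qed (use q(1) in simp)
  then have "q \<in> ?S" by (rule subring_containsI[OF S indet_S q(1)])
  then have "indet \<otimes>\<^bsub>P\<^esub> q \<in> ?S" by (rule subringE(6)[OF S indet_S])
  then have "exp_poly a \<ominus>\<^bsub>P\<^esub> indet \<otimes>\<^bsub>P\<^esub> q \<in> ?S"
    using exp_S subringE(5,7)[OF S] unfolding a_minus_def by blast
  also have "exp_poly a \<ominus>\<^bsub>P\<^esub> indet \<otimes>\<^bsub>P\<^esub> q = const a"
    unfolding q(2)[symmetric] using Suc.prems(1)
    by (simp add: a_minus_def P.minus_add P.a_assoc[symmetric] P.r_neg)
  finally show ?case .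
qed

lemma exp_poly_normalizes_const:
  assumes z: "normal_elem R z" and a: "a \<in> carrier R"
  shows "\<exists>b\<in>carrier P. exp_poly z \<otimes>\<^bsub>P\<^esub> const a = b \<otimes>\<^bsub>P\<^esub> exp_poly z"
proof -
  note ev_mult = ring_hom_mult[OF exp.eval_hom]
  have z_closed: "z \<in> carrier R" using z by (simp add: normal_elem_def)
  obtain k where "(d ^^ k) a = \<zero>" using nilpotent a unfolding locally_nilpotent_def by blast
  then obtain p where p: "p \<in> carrier P" "const a = exp.ev p"
    using const_in_range_exp[OF a] by blast
  obtain q where q: "q \<in> carrier P" "const z \<otimes>\<^bsub>P\<^esub> p = q \<otimes>\<^bsub>P\<^esub> const z"
    using normal_elemD(2)[OF normal_elem_const[OF z] p(1)] by blast
  have "exp_poly z \<otimes>\<^bsub>P\<^esub> const a = exp.ev (const z \<otimes>\<^bsub>P\<^esub> p)"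
    using z_closed p by (simp add: ev_mult exp.eval_const del: One_nat_def)
  also have "\<dots> = exp.ev q \<otimes>\<^bsub>P\<^esub> exp_poly z"
    unfolding q(2) using z_closed q(1) by (simp add: ev_mult exp.eval_const del: One_nat_def)
  finally show ?thesis using exp.eval_closed[OF q(1)] by blast
qed

end

lemma (in UP_rigid_algebra) locally_nilpotent_derivation_eq_0:
  assumes d: "CHAR('k) = 0" "alg_derivation R iota d" "locally_nilpotent R d"
    and a: "a \<in> carrier R"
  shows "d a = \<zero>"
proof -
  interpret UP_locally_nilpotent_derivation R P iota d
    using d by unfold_locales
  have "deg R (exp_poly z) = 0" if z: "normal_elem R z" "z \<noteq> \<zero>" for z
  proof -
    have z_closed: "z \<in> carrier R" using z by (simp add: normal_elem_def)
    have "same_twist R (coeff P (exp_poly z) 1) (coeff P (exp_poly z) 0)"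
      using z z_closed exp_poly_normalizes_const[OF z(1)] exp_poly_eq_0
      by (intro same_twist_coeffs) auto
    then obtain c where "d z = iota c \<otimes> z"
      using same_twist_proportional z z_closed divided_power_1 by fastforce
    then have "d z = \<zero>" by (rule derivation_eigenvector_eq_0[OF z_closed])
    then have "exp_poly z = const z"
      using z_closed divided_power_eq_0[of 1 z] by (intro up_eqI) auto
    then show ?thesis using z_closed by simp
  qed
  then have "deg R (exp_poly a) = 0"
    using deg_0_if_normal_deg_0[OF exp_poly_hom exp_poly_eq_0 exp_poly_iota _ a] by blast
  then have "coeff P (exp_poly a) 1 = \<zero>" using a by (intro deg_aboveD) auto
  then show ?thesis using a divided_power_1 by simp
qed

section \<open>Twisted convolution and leading exponents\<close>

alias lookup = Poly_Mapping.lookup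
alias single = Poly_Mapping.single
alias keys = Poly_Mapping.keys

lemma poly_mapping_induct [case_names zero single add]:
  fixes p :: "'m \<Rightarrow>\<^sub>0 'b::comm_monoid_add"
  assumes "Q 0" "\<And>u c. u \<in> keys p \<Longrightarrow> Q (single u c)" "\<And>p q. Q p \<Longrightarrow> Q q \<Longrightarrow> Q (p + q)"
  shows "Q p"
proof -
  have "p = (\<Sum>u\<in>keys p. single u (lookup p u))"
  proof (rule poly_mapping_eqI)
    show "lookup p k = lookup (\<Sum>u\<in>keys p. single u (lookup p u)) k" for k
      by (cases "k \<in> keys p")
        (auto simp: lookup_sum lookup_single when_def in_keys_iff sum.delta')
  qed
  moreover have "Q (\<Sum>u\<in>U. single u (lookup p u))" if "U \<subseteq> keys p" for U
    using finite_subset[OF that finite_keys] that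
    by (induction U rule: finite_induct) (auto intro!: assms)
  ultimately show ?thesis by (metis order.refl)
qed

definition twisted_mult ::
  "('m \<Rightarrow> 'm \<Rightarrow> 'm) \<Rightarrow> ('m \<Rightarrow> 'm \<Rightarrow> 'k) \<Rightarrow> ('m \<Rightarrow>\<^sub>0 'k) \<Rightarrow> ('m \<Rightarrow>\<^sub>0 'k) \<Rightarrow> ('m \<Rightarrow>\<^sub>0 'k::comm_ring_1)"
  where "twisted_mult f w p r =
    (\<Sum>u\<in>keys p. \<Sum>v\<in>keys r. single (f u v) (w u v * lookup p u * lookup r v))"

lemma twisted_mult_zero [simp]: "twisted_mult f w 0 r = 0" "twisted_mult f w p 0 = 0"
  by (simp_all add: twisted_mult_def)

lemma twisted_mult_single:
  "twisted_mult f w (single u a) (single v b) = single (f u v) (w u v * a * b)"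
  by (simp add: twisted_mult_def)

lemma twisted_mult_add_left:
  "twisted_mult f w (p + p') r = twisted_mult f w p r + twisted_mult f w p' r"
  unfolding twisted_mult_def
  by (rule setsum_keys_plus_distrib) (simp_all add: algebra_simps single_add sum.distrib)

lemma twisted_mult_add_right:
  "twisted_mult f w p (r + r') = twisted_mult f w p r + twisted_mult f w p r'"
  unfolding twisted_mult_def sum.distrib[symmetric]
  by (rule sum.cong[OF refl], rule setsum_keys_plus_distrib)
    (simp_all add: algebra_simps single_add)

lemma twisted_mult_minus_left: "twisted_mult f w (- p) r = - twisted_mult f w p r"
  using twisted_mult_add_left[of f w p "- p" r] by (simp add: eq_neg_iff_add_eq_0 add.commute)

lemma twisted_mult_minus_right: "twisted_mult f w p (- r) = - twisted_mult f w p r"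
  using twisted_mult_add_right[of f w p r "- r"] by (simp add: eq_neg_iff_add_eq_0 add.commute)

lemma twisted_mult_diff_left:
  "twisted_mult f w (p - p') r = twisted_mult f w p r - twisted_mult f w p' r"
  using twisted_mult_add_left[of f w p "- p'" r] by (simp add: twisted_mult_minus_left)

lemma twisted_mult_diff_right:
  "twisted_mult f w p (r - r') = twisted_mult f w p r - twisted_mult f w p r'"
  using twisted_mult_add_right[of f w p r "- r'"] by (simp add: twisted_mult_minus_right)

lemma twisted_mult_assoc:
  assumes f: "\<And>u v x. f (f u v) x = f u (f v x)"
    and w: "\<And>u v x. w u v * w (f u v) x = w v x * w u (f v x)"
  shows "twisted_mult f w (twisted_mult f w p r) s = twisted_mult f w p (twisted_mult f w r s)"
proof (induction p rule: poly_mapping_induct)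
  case (single u a)
  show ?case
  proof (induction r rule: poly_mapping_induct)
    case (single v b)
    show ?case
    proof (induction s rule: poly_mapping_induct)
      case (single x c)
      have "w (f u v) x * (w u v * a * b) * c = (w u v * w (f u v) x) * (a * b * c)"
        by (simp add: mult_ac)
      also have "\<dots> = w u (f v x) * a * (w v x * b * c)"
        unfolding w by (simp add: mult_ac)
      finally show ?case by (simp add: twisted_mult_single f)
    qed (simp_all add: twisted_mult_add_right)
  qed (simp_all add: twisted_mult_add_left twisted_mult_add_right)
qed (simp_all add: twisted_mult_add_left)

lemma keys_twisted_mult: "keys (twisted_mult f w p r) \<subseteq> {f u v |u v. u \<in> keys p \<and> v \<in> keys r}"
proof -
  have "keys (twisted_mult f w p r)
      \<subseteq> (\<Union>u\<in>keys p. \<Union>v\<in>keys r. keys (single (f u v) (w u v * lookup p u * lookup r v)))"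
    unfolding twisted_mult_def by (intro order.trans[OF keys_sum] UN_mono order.refl keys_sum)
  also have "\<dots> \<subseteq> {f u v |u v. u \<in> keys p \<and> v \<in> keys r}"
    by (auto split: if_splits)
  finally show ?thesis .
qed

lemma lookup_twisted_mult_unique:
  assumes u0: "u0 \<in> keys p" and v0: "v0 \<in> keys r"
    and unique: "\<And>u v. u \<in> keys p \<Longrightarrow> v \<in> keys r \<Longrightarrow> f u v = f u0 v0 \<Longrightarrow> u = u0 \<and> v = v0"
  shows "lookup (twisted_mult f w p r) (f u0 v0) = w u0 v0 * lookup p u0 * lookup r v0"
proof -
  let ?c = "w u0 v0 * lookup p u0 * lookup r v0"
  have "lookup (twisted_mult f w p r) (f u0 v0)
      = (\<Sum>u\<in>keys p. \<Sum>v\<in>keys r. if u = u0 then (if v = v0 then ?c else 0) else 0)"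
    unfolding twisted_mult_def lookup_sum
    by (intro sum.cong refl) (use unique in \<open>auto simp: lookup_single when_def\<close>)
  also have "\<dots> = (\<Sum>u\<in>keys p. if u = u0 then ?c else 0)"
    using v0 by (intro sum.cong refl) auto
  also have "\<dots> = ?c" using u0 by simp
  finally show ?thesis .
qed

definition lead_exp :: "('m::linorder \<Rightarrow>\<^sub>0 'k::zero) \<Rightarrow> 'm" where
  "lead_exp p = Max (keys p)"

lemma lead_exp_in_keys: "p \<noteq> 0 \<Longrightarrow> lead_exp p \<in> keys p"
  unfolding lead_exp_def by (intro Max_in) auto

lemma lookup_lead_exp: "p \<noteq> 0 \<Longrightarrow> lookup p (lead_exp p) \<noteq> 0"
  using lead_exp_in_keys by (simp add: in_keys_iff)

lemma lead_exp_ge: "u \<in> keys p \<Longrightarrow> u \<le> lead_exp p"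
  unfolding lead_exp_def by (intro Max_ge) auto

lemma lead_exp_eqI: "u \<in> keys p \<Longrightarrow> (\<And>v. v \<in> keys p \<Longrightarrow> v \<le> u) \<Longrightarrow> lead_exp p = u"
  unfolding lead_exp_def by (intro Max_eqI) auto

lemma lead_exp_single: "c \<noteq> 0 \<Longrightarrow> lead_exp (single u c) = u"
  by (rule lead_exp_eqI) auto

lemma sum_distinct_lead_exp_neq_0:
  assumes S: "finite S" "S \<noteq> {}" and "\<And>i. i \<in> S \<Longrightarrow> g i \<noteq> 0" and "inj_on (\<lambda>i. lead_exp (g i)) S"
  shows "sum g S \<noteq> 0"
proof -
  define M where "M = Max ((\<lambda>i. lead_exp (g i)) ` S)"
  have "M \<in> (\<lambda>i. lead_exp (g i)) ` S" unfolding M_def using S by (intro Max_in) auto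
  then obtain i where i: "i \<in> S" "lead_exp (g i) = M" by blast
  have "lookup (g j) M = (if j = i then lookup (g i) M else 0)" if "j \<in> S" for j
  proof (cases "j = i")
    case False
    have "lead_exp (g j) \<noteq> M" using False i that assms(4) by (auto dest: inj_onD)
    moreover have "lead_exp (g j) \<le> M" unfolding M_def using S that by (intro Max_ge) auto
    ultimately have "M \<notin> keys (g j)" using lead_exp_ge[of M "g j"] by auto
    then show ?thesis using False by (simp add: in_keys_iff)
  qed simp
  then have "lookup (sum g S) M = (\<Sum>j\<in>S. if j = i then lookup (g i) M else 0)"
    unfolding lookup_sum by (rule sum.cong[OF refl])
  then have "lookup (sum g S) M \<noteq> 0"
    using S i lookup_lead_exp[OF assms(3)[OF i(1)]] by simp
  then show ?thesis by auto
qed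

section \<open>Twisted group algebras\<close>

locale twisted_group_algebra =
  fixes bichar :: "'m::linordered_ab_group_add \<Rightarrow> 'm \<Rightarrow> 'k::field"
  assumes bichar_neq_0: "bichar u v \<noteq> 0"
    and bichar_add_left: "bichar (u + u') v = bichar u v * bichar u' v"
    and bichar_add_right: "bichar u (v + v') = bichar u v * bichar u v'"
begin

abbreviation tw_mult :: "('m \<Rightarrow>\<^sub>0 'k) \<Rightarrow> ('m \<Rightarrow>\<^sub>0 'k) \<Rightarrow> ('m \<Rightarrow>\<^sub>0 'k)" (infixl "\<star>" 70)
  where "p \<star> r \<equiv> twisted_mult (+) bichar p r"

definition scalar :: "'k \<Rightarrow> ('m \<Rightarrow>\<^sub>0 'k)" where "scalar c = single 0 c"

lemma bichar_zero [simp]: "bichar 0 v = 1" "bichar u 0 = 1"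
  using bichar_add_left[of 0 0 v] bichar_add_right[of u 0 0] bichar_neq_0 by simp_all

lemma bichar_minus_left: "bichar (- u) v = inverse (bichar u v)"
  using bichar_add_left[of u "- u" v] bichar_neq_0[of u v] by (simp add: field_simps)

lemma bichar_minus_right: "bichar u (- v) = inverse (bichar u v)"
  using bichar_add_right[of u v "- v"] bichar_neq_0[of u v] by (simp add: field_simps)

lemma bichar_diff_left: "bichar (u - u') v = bichar u v / bichar u' v"
  using bichar_add_left[of u "- u'" v] by (simp add: bichar_minus_left divide_inverse)

lemma bichar_diff_right: "bichar u (v - v') = bichar u v / bichar u v'"
  using bichar_add_right[of u v "- v'"] by (simp add: bichar_minus_right divide_inverse)

lemma tw_assoc: "(p \<star> r) \<star> s = p \<star> (r \<star> s)"
  by (rule twisted_mult_assoc) (simp_all add: add.assoc bichar_add_left bichar_add_right)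

lemma scalar_mult: "scalar c \<star> scalar d = scalar (c * d)"
  by (simp add: scalar_def twisted_mult_single)

lemma scalar_mult_single: "scalar c \<star> single u a = single u (c * a)"
  by (simp add: scalar_def twisted_mult_single)

lemma scalar_commute: "p \<star> scalar c = scalar c \<star> p"
  by (induction p rule: poly_mapping_induct)
    (simp_all add: scalar_def twisted_mult_single twisted_mult_add_right twisted_mult_add_left
      mult.commute)

lemma scalar_left_commute: "p \<star> (scalar c \<star> r) = scalar c \<star> (p \<star> r)"
  by (metis tw_assoc scalar_commute)

lemma scalar_0 [simp]: "scalar 0 = 0"
  by (simp add: scalar_def)

lemma scalar_1_mult [simp]: "scalar 1 \<star> p = p" "p \<star> scalar 1 = p"
proof -
  show "scalar 1 \<star> p = p"
    by (induction p rule: poly_mapping_induct)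
      (simp_all add: scalar_mult_single twisted_mult_add_right)
  then show "p \<star> scalar 1 = p" by (simp add: scalar_commute)
qed

lemma scalar_add: "scalar (c + d) = scalar c + scalar d"
  by (simp add: scalar_def single_add)

lemma lookup_scalar_mult: "lookup (scalar c \<star> p) u = c * lookup p u"
  by (induction p rule: poly_mapping_induct)
    (auto simp: scalar_mult_single lookup_single when_def twisted_mult_add_right lookup_add
      distrib_left)

lemma keys_scalar_mult: "c \<noteq> 0 \<Longrightarrow> keys (scalar c \<star> p) = keys p"
  by (auto simp: in_keys_iff lookup_scalar_mult)

lemma
  assumes "p \<noteq> 0" "r \<noteq> 0"
  shows tw_mult_neq_0: "p \<star> r \<noteq> 0"
    and lead_exp_tw_mult: "lead_exp (p \<star> r) = lead_exp p + lead_exp r"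
    and lookup_lead_exp_tw_mult: "lookup (p \<star> r) (lead_exp p + lead_exp r)
      = bichar (lead_exp p) (lead_exp r) * lookup p (lead_exp p) * lookup r (lead_exp r)"
proof -
  show lookup: "lookup (p \<star> r) (lead_exp p + lead_exp r)
      = bichar (lead_exp p) (lead_exp r) * lookup p (lead_exp p) * lookup r (lead_exp r)"
  proof (rule lookup_twisted_mult_unique)
    fix u v assume uv: "u \<in> keys p" "v \<in> keys r" "u + v = lead_exp p + lead_exp r"
    then have "u \<le> lead_exp p" "v \<le> lead_exp r" by (auto intro: lead_exp_ge)
    then show "u = lead_exp p \<and> v = lead_exp r"
      using uv(3)
      by (metis add_le_less_mono add_less_le_mono less_irrefl order.not_eq_order_implies_strict)
  qed (use assms lead_exp_in_keys in auto)
  then have mem: "lead_exp p + lead_exp r \<in> keys (p \<star> r)"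
    using bichar_neq_0 lookup_lead_exp[OF assms(1)] lookup_lead_exp[OF assms(2)]
    by (simp add: in_keys_iff)
  then show "p \<star> r \<noteq> 0" by auto
  show "lead_exp (p \<star> r) = lead_exp p + lead_exp r"
    using mem keys_twisted_mult[of "(+)" bichar p r]
    by (intro lead_exp_eqI) (auto intro!: add_mono lead_exp_ge)
qed

definition common_twist :: "('m \<Rightarrow>\<^sub>0 'k) \<Rightarrow> ('m \<Rightarrow>\<^sub>0 'k) \<Rightarrow> ('m \<Rightarrow>\<^sub>0 'k) \<Rightarrow> bool" where
  "common_twist u v p \<longleftrightarrow> (\<exists>p'. u \<star> p = p' \<star> u \<and> v \<star> p = p' \<star> v)"

definition commutation :: "'m \<Rightarrow> 'm \<Rightarrow> 'k" where
  "commutation u v = bichar u v / bichar v u"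

lemma commutation_diff_left: "commutation (u - u') v = commutation u v / commutation u' v"
  by (simp add: commutation_def bichar_diff_left bichar_diff_right)

lemma tw_commute:
  assumes "\<And>u v. u \<in> keys p \<Longrightarrow> v \<in> keys r \<Longrightarrow> commutation u v = c"
  shows "p \<star> r = scalar c \<star> (r \<star> p)"
proof (induction p rule: poly_mapping_induct)
  case (single u a)
  note u = this
  show ?case
  proof (induction r rule: poly_mapping_induct)
    case (single v b)
    then have "bichar u v = c * bichar v u"
      using assms[OF u single] bichar_neq_0[of v u] by (simp add: commutation_def field_simps)
    then show ?case by (simp add: twisted_mult_single scalar_mult_single add.commute mult_ac)
  qed (simp_all add: twisted_mult_add_left twisted_mult_add_right)
qed (simp_all add: twisted_mult_add_left twisted_mult_add_right)

lemma commutation_lead_exp: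
  assumes u: "u \<noteq> 0" and p: "p \<noteq> 0" and twist: "u \<star> p = p' \<star> u"
  shows "commutation (lead_exp u) (lead_exp p) = lookup p' (lead_exp p) / lookup p (lead_exp p)"
proof -
  have p': "p' \<noteq> 0" using tw_mult_neq_0[OF u p] twist by auto
  then have lead: "lead_exp p' = lead_exp p"
    using lead_exp_tw_mult[OF u p] lead_exp_tw_mult[OF p' u] twist by simp
  have "bichar (lead_exp u) (lead_exp p) * lookup p (lead_exp p)
      = bichar (lead_exp p) (lead_exp u) * lookup p' (lead_exp p)"
    using lookup_lead_exp_tw_mult[OF u p] lookup_lead_exp_tw_mult[OF p' u] twist lead
      lookup_lead_exp[OF u]
    by (simp add: add.commute)
  then show ?thesis
    using lookup_lead_exp[OF p] bichar_neq_0 by (simp add: commutation_def field_simps)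
qed

context
  fixes E :: "'m set" and T :: "('m \<Rightarrow>\<^sub>0 'k) set"
  assumes diff_closed: "e \<in> E \<Longrightarrow> e' \<in> E \<Longrightarrow> e - e' \<in> E"
    and nondegenerate: "e \<in> E \<Longrightarrow> (\<And>p. p \<in> T \<Longrightarrow> commutation e (lead_exp p) = 1) \<Longrightarrow> e = 0"
    and zero_notin: "0 \<notin> T"
begin

lemma lead_exp_eq_of_same_twist:
  assumes u: "u \<noteq> 0" "keys u \<subseteq> E" and v: "v \<noteq> 0" "keys v \<subseteq> E"
    and twist: "\<And>p. p \<in> T \<Longrightarrow> common_twist u v p"
  shows "lead_exp u = lead_exp v"
proof -
  have "commutation (lead_exp u - lead_exp v) (lead_exp p) = 1" if p: "p \<in> T" for p
  proof -
    obtain p' where p': "u \<star> p = p' \<star> u" "v \<star> p = p' \<star> v"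
      using twist[OF p] unfolding common_twist_def by blast
    have "p \<noteq> 0" using p zero_notin by auto
    then have "commutation (lead_exp u) (lead_exp p) = commutation (lead_exp v) (lead_exp p)"
      using p' u(1) v(1) by (simp add: commutation_lead_exp)
    then show ?thesis by (simp add: commutation_diff_left) (simp add: commutation_def bichar_neq_0)
  qed
  moreover have "lead_exp u - lead_exp v \<in> E"
    using u v lead_exp_in_keys by (blast intro: diff_closed)
  ultimately show ?thesis using nondegenerate by fastforce
qed

text \<open>Subtract from \<open>u\<close> the multiple of \<open>v\<close> with the same leading coefficient: the difference still
  has the common twist, hence the leading exponent of \<open>v\<close>, but its coefficient there vanishes.\<close>

lemma tw_same_twist_proportional:
  assumes u: "keys u \<subseteq> E" and v: "v \<noteq> 0" "keys v \<subseteq> E"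
    and twist: "\<And>p. p \<in> T \<Longrightarrow> common_twist u v p"
  shows "\<exists>c. u = scalar c \<star> v"
proof -
  define c where "c = lookup u (lead_exp v) / lookup v (lead_exp v)"
  define r where "r = u - scalar c \<star> v"
  have lookup_r: "lookup r k = lookup u k - c * lookup v k" for k
    by (simp add: r_def lookup_minus lookup_scalar_mult)
  have "r = 0"
  proof (rule ccontr)
    assume r: "r \<noteq> 0"
    have "r \<star> p = p' \<star> r" if "u \<star> p = p' \<star> u" "v \<star> p = p' \<star> v" for p p'
      using that by (simp add: r_def twisted_mult_diff_left twisted_mult_diff_right tw_assoc
          scalar_left_commute)
    then have "common_twist r v p" if "p \<in> T" for p
      using twist[OF that] unfolding common_twist_def by blast
    moreover have "keys r \<subseteq> keys u \<union> keys v" by (auto simp: in_keys_iff lookup_r)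
    then have "keys r \<subseteq> E" using u v(2) by blast
    ultimately have "lead_exp r = lead_exp v" using r v by (intro lead_exp_eq_of_same_twist)
    moreover have "lookup r (lead_exp v) = 0"
      using lookup_lead_exp[OF v(1)] by (simp add: lookup_r c_def)
    ultimately show False using lookup_lead_exp[OF r] by simp
  qed
  then show ?thesis by (auto simp: r_def)
qed

end

primrec word_eval :: "('g \<Rightarrow> 'm \<Rightarrow>\<^sub>0 'k) \<Rightarrow> 'g list \<Rightarrow> ('m \<Rightarrow>\<^sub>0 'k)" where
  "word_eval \<theta> [] = scalar 1"
| "word_eval \<theta> (g # w) = \<theta> g \<star> word_eval \<theta> w"

lemma word_eval_append: "word_eval \<theta> (u @ v) = word_eval \<theta> u \<star> word_eval \<theta> v"
  by (induction u) (simp_all add: tw_assoc)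

lemma word_eval_neq_0_lead_exp:
  assumes "\<And>g. g \<in> set w \<Longrightarrow> \<theta> g \<noteq> 0"
  shows "word_eval \<theta> w \<noteq> 0 \<and> lead_exp (word_eval \<theta> w) = (\<Sum>g\<leftarrow>w. lead_exp (\<theta> g))"
  using assms
proof (induction w)
  case Nil
  have "scalar 1 \<noteq> 0" by (metis lookup_single_eq lookup_zero scalar_def zero_neq_one)
  then show ?case using lead_exp_single[of "1::'k" "0::'m"] by (simp add: scalar_def)
next
  case (Cons g w)
  then show ?case using tw_mult_neq_0 lead_exp_tw_mult by simp
qed

lemma keys_word_eval:
  assumes "0 \<in> E" "\<And>e e'. e \<in> E \<Longrightarrow> e' \<in> E \<Longrightarrow> e + e' \<in> E"
    and "\<And>g. g \<in> set w \<Longrightarrow> keys (\<theta> g) \<subseteq> E"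
  shows "keys (word_eval \<theta> w) \<subseteq> E"
  using assms(3)
proof (induction w)
  case Nil
  then show ?case using assms(1) by (simp add: scalar_def)
next
  case (Cons g w)
  then have "keys (\<theta> g) \<subseteq> E" "keys (word_eval \<theta> w) \<subseteq> E" by simp_all
  then show ?case using keys_twisted_mult[of "(+)" bichar "\<theta> g" "word_eval \<theta> w"] assms(2) by force
qed

definition free_eval :: "('g \<Rightarrow> 'm \<Rightarrow>\<^sub>0 'k) \<Rightarrow> ('g list \<Rightarrow>\<^sub>0 'k) \<Rightarrow> ('m \<Rightarrow>\<^sub>0 'k)" where
  "free_eval \<theta> p = (\<Sum>w\<in>keys p. scalar (lookup p w) \<star> word_eval \<theta> w)"

lemma free_eval_zero [simp]: "free_eval \<theta> 0 = 0"
  by (simp add: free_eval_def)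

lemma free_eval_single: "free_eval \<theta> (single w c) = scalar c \<star> word_eval \<theta> w"
  by (simp add: free_eval_def)

lemma free_eval_add: "free_eval \<theta> (p + r) = free_eval \<theta> p + free_eval \<theta> r"
  unfolding free_eval_def
  by (rule setsum_keys_plus_distrib) (simp_all add: scalar_add twisted_mult_add_left)

lemma free_eval_uminus: "free_eval \<theta> (- p) = - free_eval \<theta> p"
  using free_eval_add[of \<theta> p "- p"] by (simp add: eq_neg_iff_add_eq_0 add.commute)

lemma free_eval_diff: "free_eval \<theta> (p - r) = free_eval \<theta> p - free_eval \<theta> r"
  using free_eval_add[of \<theta> p "- r"] by (simp add: free_eval_uminus)

lemma free_eval_mult:
  "free_eval \<theta> (twisted_mult (@) (\<lambda>_ _. 1) p r) = free_eval \<theta> p \<star> free_eval \<theta> r"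
proof (induction p rule: poly_mapping_induct)
  case (single u a)
  show ?case
  proof (induction r rule: poly_mapping_induct)
    case (single v b)
    have "scalar (a * b) \<star> (word_eval \<theta> u \<star> word_eval \<theta> v)
        = scalar a \<star> (scalar b \<star> (word_eval \<theta> u \<star> word_eval \<theta> v))"
      by (simp flip: tw_assoc scalar_mult)
    also have "scalar b \<star> (word_eval \<theta> u \<star> word_eval \<theta> v)
        = word_eval \<theta> u \<star> (scalar b \<star> word_eval \<theta> v)"
      by (rule scalar_left_commute[symmetric])
    finally show ?case by (simp add: twisted_mult_single free_eval_single word_eval_append tw_assoc)
  qed (simp_all add: twisted_mult_add_right free_eval_add)
qed (simp_all add: twisted_mult_add_left free_eval_add)

lemma keys_free_eval:
  assumes "\<And>w. w \<in> keys p \<Longrightarrow> keys (word_eval \<theta> w) \<subseteq> E"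
  shows "keys (free_eval \<theta> p) \<subseteq> E"
proof -
  have "keys (free_eval \<theta> p) \<subseteq> (\<Union>w\<in>keys p. keys (scalar (lookup p w) \<star> word_eval \<theta> w))"
    unfolding free_eval_def by (rule keys_sum)
  also have "\<dots> \<subseteq> E" using assms by (auto simp: keys_scalar_mult in_keys_iff)
  finally show ?thesis .
qed

lemma free_eval_eq_0_imp_eq_0:
  assumes "\<And>w. w \<in> keys p \<Longrightarrow> word_eval \<theta> w \<noteq> 0" "inj_on (\<lambda>w. lead_exp (word_eval \<theta> w)) (keys p)"
    and "free_eval \<theta> p = 0"
  shows "p = 0"
proof (rule ccontr)
  assume "p \<noteq> 0"
  have "scalar (lookup p w) \<star> word_eval \<theta> w \<noteq> 0 \<and>
      lead_exp (scalar (lookup p w) \<star> word_eval \<theta> w) = lead_exp (word_eval \<theta> w)"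
    if "w \<in> keys p" for w
    using that assms(1)[OF that] keys_scalar_mult[of "lookup p w" "word_eval \<theta> w"]
    unfolding lead_exp_def by (metis in_keys_iff keys_eq_empty)
  then have "free_eval \<theta> p \<noteq> 0"
    unfolding free_eval_def using \<open>p \<noteq> 0\<close> assms(2)
    by (intro sum_distinct_lead_exp_neq_0) (auto cong: inj_on_cong)
  with assms(3) show False by blast
qed

end

section \<open>The quantum torus\<close>

fun gen_index :: "gen \<Rightarrow> nat" where "gen_index (X i) = i" | "gen_index (Y i) = i"
fun gen_sign :: "gen \<Rightarrow> int" where "gen_sign (X i) = 1" | "gen_sign (Y i) = - 1"

lemma gens_iff: "g \<in> gens n \<longleftrightarrow> gen_index g \<in> {1..n}"
  by (cases g) (auto simp: gens_def)

text \<open>The quantum torus with generators \<open>x\<^sub>i, z\<^sub>i\<close> has a basis of monomials \<open>x\<^sup>a z\<^sup>b\<close>, whose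
  exponents are stored in one vector: that of \<open>x\<^sub>i\<close> at \<open>2 * i + 1\<close> and that of \<open>z\<^sub>i\<close> at \<open>2 * i\<close>.\<close>

definition x_exp :: "(nat \<Rightarrow>\<^sub>0 int) \<Rightarrow> nat \<Rightarrow> int" where "x_exp u i = lookup u (2 * i + 1)"
definition z_exp :: "(nat \<Rightarrow>\<^sub>0 int) \<Rightarrow> nat \<Rightarrow> int" where "z_exp u i = lookup u (2 * i)"
definition x_unit :: "nat \<Rightarrow> (nat \<Rightarrow>\<^sub>0 int)" where "x_unit i = single (2 * i + 1) 1"
definition z_unit :: "nat \<Rightarrow> (nat \<Rightarrow>\<^sub>0 int)" where "z_unit i = single (2 * i) 1"

definition torus_exps :: "nat \<Rightarrow> (nat \<Rightarrow>\<^sub>0 int) set" where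
  "torus_exps n = {u. \<forall>i. i \<notin> {1..n} \<longrightarrow> x_exp u i = 0 \<and> z_exp u i = 0}"

lemma exp_simps [simp]:
  "x_exp 0 i = 0" "x_exp (u + v) i = x_exp u i + x_exp v i"
  "x_exp (- u) i = - x_exp u i" "x_exp (u - v) i = x_exp u i - x_exp v i"
  "z_exp 0 i = 0" "z_exp (u + v) i = z_exp u i + z_exp v i"
  "z_exp (- u) i = - z_exp u i" "z_exp (u - v) i = z_exp u i - z_exp v i"
  by (simp_all add: x_exp_def z_exp_def lookup_add lookup_minus)

lemma exp_unit_simps [simp]:
  "x_exp (x_unit j) i = (if i = j then 1 else 0)" "z_exp (x_unit j) i = 0"
  "x_exp (z_unit j) i = 0" "z_exp (z_unit j) i = (if i = j then 1 else 0)"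
proof -
  have "2 * j + 1 \<noteq> 2 * i" "2 * j \<noteq> 2 * i + 1" by presburger+
  then show "z_exp (x_unit j) i = 0" "x_exp (z_unit j) i = 0"
    by (simp_all add: z_exp_def x_unit_def x_exp_def z_unit_def lookup_single when_def)
qed (auto simp: x_exp_def x_unit_def z_exp_def z_unit_def lookup_single when_def)

lemma exp_eqI:
  assumes "\<And>i. x_exp u i = x_exp v i" "\<And>i. z_exp u i = z_exp v i"
  shows "u = v"
proof (rule poly_mapping_eqI)
  show "lookup u k = lookup v k" for k
    using assms[of "k div 2"] by (cases "even k") (simp_all add: x_exp_def z_exp_def)
qed

lemma z_unit_pos: "z_unit i > 0"
  unfolding z_unit_def less_poly_mapping.rep_eq less_fun_def
  by (rule exI[of _ "2 * i"]) (auto simp: lookup_single when_def)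

lemma prod_eq_single:
  assumes "finite A" "i \<in> A" "\<And>k. k \<in> A \<Longrightarrow> k \<noteq> i \<Longrightarrow> f k = 1"
  shows "prod f A = f i"
  using prod.mono_neutral_right[of A "{i}" f] assms by simp

locale quantum_weyl =
  fixes n :: nat and q :: "nat \<Rightarrow> 'k::field" and lam :: "nat \<Rightarrow> nat \<Rightarrow> 'k"
  assumes q_nz: "i \<in> {1..n} \<Longrightarrow> q i \<noteq> 0"
    and lam_nz: "i \<in> {1..n} \<Longrightarrow> j \<in> {1..n} \<Longrightarrow> lam i j \<noteq> 0"
    and lam_inv: "i \<in> {1..n} \<Longrightarrow> j \<in> {1..n} \<Longrightarrow> lam i j = inverse (lam j i)"
    and q_not_root: "k \<in> {1..n} \<Longrightarrow> (m::nat) \<ge> 1 \<Longrightarrow> q k ^ m \<noteq> 1"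
begin

definition lam_upper :: "nat \<Rightarrow> nat \<Rightarrow> 'k" where "lam_upper i j = (if i < j then lam i j else 1)"

definition cocycle :: "(nat \<Rightarrow>\<^sub>0 int) \<Rightarrow> (nat \<Rightarrow>\<^sub>0 int) \<Rightarrow> 'k" where
  "cocycle u v = (\<Prod>i\<in>{1..n}. q i powi (x_exp u i * z_exp v i))
     * (\<Prod>i\<in>{1..n}. \<Prod>j\<in>{1..n}. lam_upper i j powi (x_exp u i * x_exp v j))"

lemma lam_upper_nz: "i \<in> {1..n} \<Longrightarrow> j \<in> {1..n} \<Longrightarrow> lam_upper i j \<noteq> 0"
  using lam_nz by (simp add: lam_upper_def)

end

sublocale quantum_weyl \<subseteq> twisted_group_algebra cocycle
proof
  fix u u' v v' :: "nat \<Rightarrow>\<^sub>0 int"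
  show "cocycle u v \<noteq> 0"
    using q_nz lam_upper_nz by (auto simp: cocycle_def)
  have "cocycle (u + u') v
      = (\<Prod>i\<in>{1..n}. q i powi (x_exp u i * z_exp v i) * q i powi (x_exp u' i * z_exp v i))
        * (\<Prod>i\<in>{1..n}. \<Prod>j\<in>{1..n}. lam_upper i j powi (x_exp u i * x_exp v j)
            * lam_upper i j powi (x_exp u' i * x_exp v j))"
    unfolding cocycle_def using q_nz lam_upper_nz
    by (intro arg_cong2[where f = "(*)"] prod.cong refl) (auto simp: distrib_right power_int_add)
  then show "cocycle (u + u') v = cocycle u v * cocycle u' v"
    by (simp only: cocycle_def prod.distrib mult_ac)
  have "cocycle u (v + v')
      = (\<Prod>i\<in>{1..n}. q i powi (x_exp u i * z_exp v i) * q i powi (x_exp u i * z_exp v' i))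
        * (\<Prod>i\<in>{1..n}. \<Prod>j\<in>{1..n}. lam_upper i j powi (x_exp u i * x_exp v j)
            * lam_upper i j powi (x_exp u i * x_exp v' j))"
    unfolding cocycle_def using q_nz lam_upper_nz
    by (intro arg_cong2[where f = "(*)"] prod.cong refl) (auto simp: distrib_left power_int_add)
  then show "cocycle u (v + v') = cocycle u v * cocycle u v'"
    by (simp only: cocycle_def prod.distrib mult_ac)
qed

context quantum_weyl
begin

notation tw_mult (infixl "\<star>" 70)

lemma cocycle_eq_1: "(\<And>i. i \<in> {1..n} \<Longrightarrow> x_exp u i = 0) \<Longrightarrow> cocycle u v = 1"
  by (simp add: cocycle_def)

lemma cocycle_no_x_right:
  "(\<And>i. i \<in> {1..n} \<Longrightarrow> x_exp v i = 0) \<Longrightarrow> cocycle u v = (\<Prod>i\<in>{1..n}. q i powi (x_exp u i * z_exp v i))"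
  by (simp add: cocycle_def)

lemma cocycle_unit_unit:
  assumes "i \<in> {1..n}"
  shows "cocycle (x_unit i) (x_unit i) = 1" "cocycle (x_unit i) (z_unit i) = q i"
proof -
  have "(\<Prod>k\<in>{1..n}. \<Prod>j\<in>{1..n}. lam_upper k j powi (x_exp (x_unit i) k * x_exp (x_unit i) j)) = 1"
    by (intro prod.neutral ballI) (auto simp: lam_upper_def)
  then show "cocycle (x_unit i) (x_unit i) = 1" by (simp add: cocycle_def)
  show "cocycle (x_unit i) (z_unit i) = q i"
    using assms by (subst cocycle_no_x_right) (simp_all add: prod_eq_single[of _ i])
qed

lemma commutation_z_unit:
  assumes "i \<in> {1..n}"
  shows "commutation u (z_unit i) = q i powi x_exp u i"
proof -
  have "cocycle u (z_unit i) = q i powi x_exp u i"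
    using assms by (subst cocycle_no_x_right) (simp_all add: prod_eq_single[of _ i])
  then show ?thesis using assms by (simp add: commutation_def cocycle_eq_1)
qed

lemma commutation_x_unit_no_x:
  assumes "\<And>j. j \<in> {1..n} \<Longrightarrow> x_exp u j = 0" "i \<in> {1..n}"
  shows "commutation u (x_unit i) = inverse (q i powi z_exp u i)"
proof -
  have "cocycle (x_unit i) u = q i powi z_exp u i"
    using assms by (subst cocycle_no_x_right) (simp_all add: prod_eq_single[of _ i])
  moreover have "cocycle u (x_unit i) = 1" by (rule cocycle_eq_1[OF assms(1)])
  ultimately show ?thesis by (simp add: commutation_def divide_inverse)
qed

lemma q_powi_eq_1_imp:
  assumes "i \<in> {1..n}" "q i powi a = 1"
  shows "a = 0"
proof (rule ccontr)
  assume "a \<noteq> 0"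
  then have "nat \<bar>a\<bar> \<ge> 1" by simp
  moreover have "q i ^ nat \<bar>a\<bar> = 1"
    using assms(2) by (cases "a \<ge> 0") (auto simp: power_int_def power_inverse)
  ultimately show False using q_not_root[OF assms(1)] by blast
qed

lemma commutation_nondegenerate:
  assumes u: "u \<in> torus_exps n"
    and z: "\<And>i. i \<in> {1..n} \<Longrightarrow> commutation u (z_unit i) = 1"
    and x: "\<And>i. i \<in> {1..n} \<Longrightarrow> commutation u (x_unit i) = 1"
  shows "u = 0"
proof -
  have x_zero: "x_exp u i = 0" if "i \<in> {1..n}" for i
    using z[OF that] q_powi_eq_1_imp[OF that, of "x_exp u i"]
    by (simp add: commutation_z_unit[OF that])
  have "z_exp u i = 0" if "i \<in> {1..n}" for i
  proof -
    have "commutation u (x_unit i) = inverse (q i powi z_exp u i)"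
      using x_zero that by (rule commutation_x_unit_no_x)
    then show ?thesis using x[OF that] q_powi_eq_1_imp[OF that] by simp
  qed
  with x_zero u show ?thesis
    by (intro exp_eqI) (auto simp: torus_exps_def)
qed

definition supported_at :: "nat \<Rightarrow> int \<Rightarrow> (nat \<Rightarrow>\<^sub>0 int) set" where
  "supported_at i s = {u. (\<forall>k. x_exp u k = (if k = i then s else 0)) \<and> (\<forall>k. k \<noteq> i \<longrightarrow> z_exp u k = 0)}"

lemma cocycle_supported_at:
  assumes i: "i \<in> {1..n}" and j: "j \<in> {1..n}" "i \<noteq> j"
    and u: "u \<in> supported_at i s" and v: "v \<in> supported_at j t"
  shows "cocycle u v = lam_upper i j powi (s * t)"
proof -
  have "(\<Prod>k\<in>{1..n}. q k powi (x_exp u k * z_exp v k)) = 1"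
    using u v j(2) by (intro prod.neutral) (auto simp: supported_at_def)
  moreover have "(\<Prod>k\<in>{1..n}. \<Prod>l\<in>{1..n}. lam_upper k l powi (x_exp u k * x_exp v l))
      = (\<Prod>l\<in>{1..n}. lam_upper i l powi (x_exp u i * x_exp v l))"
    using i u by (intro prod_eq_single) (simp_all add: supported_at_def)
  moreover have "\<dots> = lam_upper i j powi (x_exp u i * x_exp v j)"
    using j v by (intro prod_eq_single) (simp_all add: supported_at_def)
  ultimately show ?thesis using u v by (simp add: cocycle_def supported_at_def)
qed

lemma commutation_supported_at:
  assumes "i \<in> {1..n}" "j \<in> {1..n}" "i \<noteq> j" "u \<in> supported_at i s" "v \<in> supported_at j t"
  shows "commutation u v = lam i j powi (s * t)"
proof -
  have "cocycle u v = lam_upper i j powi (s * t)" "cocycle v u = lam_upper j i powi (s * t)"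
    using assms cocycle_supported_at[of i j u s v t] cocycle_supported_at[of j i v t u s]
    by (simp_all add: mult.commute)
  then show ?thesis
    using assms(3) lam_inv[OF assms(1,2)]
    by (cases "i < j")
      (simp_all add: commutation_def lam_upper_def power_int_inverse divide_inverse)
qed

definition torus_z :: "nat \<Rightarrow> ((nat \<Rightarrow>\<^sub>0 int) \<Rightarrow>\<^sub>0 'k)" where "torus_z i = single (z_unit i) 1"

fun torus_gen :: "gen \<Rightarrow> ((nat \<Rightarrow>\<^sub>0 int) \<Rightarrow>\<^sub>0 'k)" where
  "torus_gen (X i) = single (x_unit i) 1"
| "torus_gen (Y i) = scalar (inverse (q i - 1))
    \<star> (single (z_unit i - x_unit i) 1 - single (- x_unit i) 1)"

definition gen_lead :: "gen \<Rightarrow> (nat \<Rightarrow>\<^sub>0 int)" where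
  "gen_lead g = (case g of X i \<Rightarrow> x_unit i | Y i \<Rightarrow> z_unit i - x_unit i)"

lemma q_minus_1_nz: "i \<in> {1..n} \<Longrightarrow> q i - 1 \<noteq> 0"
  using q_not_root[of i 1] by simp

lemma keys_torus_gen_Y:
  assumes "i \<in> {1..n}"
  shows "keys (torus_gen (Y i)) = {z_unit i - x_unit i, - x_unit i}"
proof -
  have "z_unit i \<noteq> 0" using z_unit_pos[of i] by auto
  then show ?thesis
    using q_minus_1_nz[OF assms]
    by (auto simp: keys_scalar_mult in_keys_iff lookup_minus lookup_single when_def
        split: if_splits)
qed

lemma
  assumes g: "g \<in> gens n"
  shows torus_gen_neq_0: "torus_gen g \<noteq> 0"
    and lead_exp_torus_gen: "lead_exp (torus_gen g) = gen_lead g"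
proof -
  have "gen_lead g \<in> keys (torus_gen g) \<and> (\<forall>v\<in>keys (torus_gen g). v \<le> gen_lead g)"
  proof (cases g)
    case (X i)
    then show ?thesis by (simp add: gen_lead_def)
  next
    case (Y i)
    then have "i \<in> {1..n}" using g by (simp add: gens_iff)
    moreover have "- x_unit i \<le> z_unit i - x_unit i"
      using z_unit_pos[of i] by (simp add: less_imp_le)
    ultimately show ?thesis
      using Y keys_torus_gen_Y by (simp add: gen_lead_def del: torus_gen.simps)
  qed
  then show "torus_gen g \<noteq> 0" "lead_exp (torus_gen g) = gen_lead g"
    by (auto intro!: lead_exp_eqI)
qed

lemma keys_torus_gen_supported:
  assumes "g \<in> gens n"
  shows "keys (torus_gen g) \<subseteq> supported_at (gen_index g) (gen_sign g)"
proof (cases g)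
  case (X i)
  then show ?thesis by (simp add: supported_at_def)
next
  case (Y i)
  then have "i \<in> {1..n}" using assms by (simp add: gens_iff)
  with Y show ?thesis
    by (simp add: keys_torus_gen_Y supported_at_def del: torus_gen.simps)
qed

text \<open>For \<open>i \<noteq> j\<close>, the defining relations between \<open>x\<^sub>i\<close> or \<open>y\<^sub>i\<close> and \<open>x\<^sub>j\<close> or \<open>y\<^sub>j\<close> all have
  the form \<open>g h = swap_coeff g h \<cdot> h g\<close>.\<close>

definition swap_coeff :: "gen \<Rightarrow> gen \<Rightarrow> 'k" where
  "swap_coeff g h = lam (gen_index g) (gen_index h) powi (gen_sign g * gen_sign h)"

lemma swap_coeff_inverse:
  assumes "g \<in> gens n" "h \<in> gens n"
  shows "swap_coeff h g = inverse (swap_coeff g h)"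
  using lam_inv[of "gen_index h" "gen_index g"] assms
  by (simp add: swap_coeff_def gens_iff power_int_inverse mult.commute)

lemma swap_coeff_neq_0: "g \<in> gens n \<Longrightarrow> h \<in> gens n \<Longrightarrow> swap_coeff g h \<noteq> 0"
  using lam_nz by (simp add: swap_coeff_def gens_iff)

lemma torus_gen_swap:
  assumes g: "g \<in> gens n" and h: "h \<in> gens n" and ne: "gen_index g \<noteq> gen_index h"
  shows "torus_gen g \<star> torus_gen h = scalar (swap_coeff g h) \<star> (torus_gen h \<star> torus_gen g)"
proof (rule tw_commute)
  fix u v assume "u \<in> keys (torus_gen g)" "v \<in> keys (torus_gen h)"
  then show "commutation u v = swap_coeff g h"
    using keys_torus_gen_supported[OF g] keys_torus_gen_supported[OF h] g h ne
    unfolding swap_coeff_def gens_iff by (intro commutation_supported_at) auto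
qed

lemma torus_gen_z_commute:
  assumes g: "g \<in> gens n" and i: "i \<in> {1..n}"
  shows "\<exists>c. torus_z i \<star> torus_gen g = scalar c \<star> (torus_gen g \<star> torus_z i)"
proof -
  let ?c = "q i powi (if i = gen_index g then gen_sign g else 0)"
  have "commutation v u = inverse ?c" if "u \<in> keys (torus_gen g)" "v \<in> keys (torus_z i)" for u v
  proof -
    have "u \<in> supported_at (gen_index g) (gen_sign g)"
      using that(1) keys_torus_gen_supported[OF g] by blast
    then have "commutation u v = ?c"
      using that(2) i by (simp add: torus_z_def commutation_z_unit supported_at_def)
    then show ?thesis by (metis commutation_def inverse_divide)
  qed
  then show ?thesis using tw_commute[of "torus_z i" "torus_gen g"] by blast
qed

lemma torus_gen_Y_X:
  assumes i: "i \<in> {1..n}"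
  shows "torus_gen (Y i) \<star> torus_gen (X i) = scalar (inverse (q i - 1)) \<star> (torus_z i - scalar 1)"
proof -
  have "cocycle (z_unit i) (x_unit i) = 1" by (rule cocycle_eq_1) simp
  then show ?thesis
    using cocycle_unit_unit[OF i] unfolding torus_gen.simps tw_assoc
    by (simp add: twisted_mult_diff_left twisted_mult_single bichar_diff_left bichar_minus_left
        torus_z_def scalar_def)
qed

lemma torus_gen_X_Y:
  assumes i: "i \<in> {1..n}"
  shows "torus_gen (X i) \<star> torus_gen (Y i)
    = scalar (inverse (q i - 1)) \<star> (scalar (q i) \<star> torus_z i - scalar 1)"
  using cocycle_unit_unit[OF i] unfolding torus_gen.simps scalar_left_commute
  by (simp add: twisted_mult_diff_right twisted_mult_single bichar_diff_right bichar_minus_right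
      torus_z_def scalar_def)

lemma torus_weyl_relation:
  assumes i: "i \<in> {1..n}"
  shows "torus_gen (X i) \<star> torus_gen (Y i)
    = scalar (q i) \<star> (torus_gen (Y i) \<star> torus_gen (X i)) + scalar 1"
proof -
  let ?c = "inverse (q i - 1)"
  have "q i * ?c - ?c = 1"
    using right_inverse[OF q_minus_1_nz[OF i]] by (simp only: left_diff_distrib mult_1)
  then have "scalar 1 = scalar (q i * ?c) - scalar ?c"
    by (simp add: scalar_def flip: single_diff)
  then show ?thesis
    unfolding torus_gen_X_Y[OF i] torus_gen_Y_X[OF i] torus_z_def scalar_mult_single
      twisted_mult_diff_right scalar_mult by (simp add: mult.commute)
qed

lemma torus_z_neq_0: "torus_z i \<noteq> 0"
  using lookup_single_eq[of "z_unit i" "1::'k"] unfolding torus_z_def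
  by (metis lookup_zero zero_neq_one)

lemma lead_exp_torus_z: "lead_exp (torus_z i) = z_unit i"
  by (simp add: torus_z_def lead_exp_single)

lemma torus_same_twist_proportional:
  assumes u: "keys u \<subseteq> torus_exps n" and v: "v \<noteq> 0" "keys v \<subseteq> torus_exps n"
    and z: "\<And>i. i \<in> {1..n} \<Longrightarrow> common_twist u v (torus_z i)"
    and x: "\<And>i. i \<in> {1..n} \<Longrightarrow> common_twist u v (torus_gen (X i))"
  shows "\<exists>c. u = scalar c \<star> v"
proof (rule tw_same_twist_proportional)
  let ?T = "torus_z ` {1..n} \<union> (\<lambda>i. torus_gen (X i)) ` {1..n}"
  show "e - e' \<in> torus_exps n" if "e \<in> torus_exps n" "e' \<in> torus_exps n" for e e'
    using that by (simp add: torus_exps_def)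
  show "e = 0" if "e \<in> torus_exps n" "\<And>p. p \<in> ?T \<Longrightarrow> commutation e (lead_exp p) = 1" for e
  proof (rule commutation_nondegenerate[OF that(1)])
    fix i assume i: "i \<in> {1..n}"
    show "commutation e (z_unit i) = 1"
      using that(2)[of "torus_z i"] i by (simp add: lead_exp_torus_z)
    show "commutation e (x_unit i) = 1"
      using that(2)[of "torus_gen (X i)"] i by (simp add: lead_exp_single)
  qed
  show "0 \<notin> ?T" using torus_z_neq_0 torus_gen_neq_0[of "X _"] by (auto simp: gens_iff image_iff)
  show "common_twist u v p" if "p \<in> ?T" for p
    using that z x by blast
qed (use u v in auto)

end

section \<open>The free algebra\<close>

lemma fa_mult_eq_twisted_mult: "fa_mult = twisted_mult (@) (\<lambda>_ _. 1)"
  by (intro ext) (simp add: fa_mult_def twisted_mult_def)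

lemma fa_mult_single: "fa_mult (single u a) (single v b) = single (u @ v) (a * b)"
  by (simp add: fa_mult_eq_twisted_mult twisted_mult_single)

lemma fa_mult_add_left: "fa_mult (p + p') r = fa_mult p r + fa_mult p' r"
  and fa_mult_add_right: "fa_mult p (r + r') = fa_mult p r + fa_mult p r'"
  and fa_mult_diff_left: "fa_mult (p - p') r = fa_mult p r - fa_mult p' r"
  and fa_mult_diff_right: "fa_mult p (r - r') = fa_mult p r - fa_mult p r'"
  and fa_mult_zero [simp]: "fa_mult 0 r = 0" "fa_mult p 0 = 0"
  by (simp_all add: fa_mult_eq_twisted_mult twisted_mult_add_left twisted_mult_add_right
      twisted_mult_diff_left twisted_mult_diff_right)

lemma fa_mult_assoc: "fa_mult (fa_mult p r) s = fa_mult p (fa_mult r s)"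
  unfolding fa_mult_eq_twisted_mult by (rule twisted_mult_assoc) simp_all

lemma fa_sc_mult_single: "fa_mult (fa_sc c) (single u a) = single u (c * a)"
  by (simp add: fa_sc_def fa_mult_single)

lemma fa_mult_one: "fa_mult (single [] 1) p = p" "fa_mult p (single [] 1) = p"
  by (induction p rule: poly_mapping_induct)
    (simp_all add: fa_mult_single fa_mult_add_left fa_mult_add_right)

lemma free_alg_simps [simp]:
  "mult (free_alg n) = fa_mult" "one (free_alg n) = single [] 1"
  "zero (free_alg n) = 0" "add (free_alg n) = (+)"
  by (simp_all add: free_alg_def)

lemma mem_free_alg: "p \<in> carrier (free_alg n) \<longleftrightarrow> (\<forall>w\<in>keys p. set w \<subseteq> gens n)"
  by (simp add: free_alg_def)

lemma free_alg_single: "set w \<subseteq> gens n \<Longrightarrow> single w c \<in> carrier (free_alg n)"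
  by (simp add: mem_free_alg)

lemma free_alg_zero: "0 \<in> carrier (free_alg n)"
  by (simp add: mem_free_alg)

lemma free_alg_add:
  "p \<in> carrier (free_alg n) \<Longrightarrow> r \<in> carrier (free_alg n) \<Longrightarrow> p + r \<in> carrier (free_alg n)"
  using Poly_Mapping.keys_add[of p r] by (auto simp: mem_free_alg)

lemma free_alg_uminus: "p \<in> carrier (free_alg n) \<Longrightarrow> - p \<in> carrier (free_alg n)"
  by (simp add: mem_free_alg)

lemma free_alg_diff:
  "p \<in> carrier (free_alg n) \<Longrightarrow> r \<in> carrier (free_alg n) \<Longrightarrow> p - r \<in> carrier (free_alg n)"
  using keys_diff[of p r] by (auto simp: mem_free_alg)

lemma free_alg_mult:
  "p \<in> carrier (free_alg n) \<Longrightarrow> r \<in> carrier (free_alg n) \<Longrightarrow> fa_mult p r \<in> carrier (free_alg n)"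
  using keys_twisted_mult[of "(@)" "\<lambda>_ _. 1" p r]
  by (fastforce simp: mem_free_alg fa_mult_eq_twisted_mult)

lemma free_alg_fa_sc: "fa_sc c \<in> carrier (free_alg n)"
  by (simp add: fa_sc_def free_alg_single)

lemma free_alg_induct [consumes 1, case_names single add]:
  assumes p: "p \<in> carrier (free_alg n)"
    and "\<And>w c. set w \<subseteq> gens n \<Longrightarrow> Q (single w c)"
    and "\<And>p r. p \<in> carrier (free_alg n) \<Longrightarrow> r \<in> carrier (free_alg n) \<Longrightarrow> Q p \<Longrightarrow> Q r \<Longrightarrow> Q (p + r)"
  shows "Q p"
proof -
  have "p \<in> carrier (free_alg n) \<and> Q p"
  proof (induction p rule: poly_mapping_induct)
    case zero
    then show ?case using assms(2)[of "[]" 0] by (simp add: free_alg_zero)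
  next
    case (single u c)
    then show ?case using p assms(2) by (auto simp: mem_free_alg)
  next
    case (add p r)
    then show ?case using assms(3) free_alg_add by blast
  qed
  then show ?thesis ..
qed

lemma free_alg_ring: "ring (free_alg n :: 'k::comm_ring_1 fa ring)"
proof (intro ringI abelian_groupI monoidI)
  fix x :: "'k fa" assume "x \<in> carrier (free_alg n)"
  then show "\<exists>y\<in>carrier (free_alg n). y \<oplus>\<^bsub>free_alg n\<^esub> x = \<zero>\<^bsub>free_alg n\<^esub>"
    by (intro bexI[of _ "- x"]) (auto intro: free_alg_uminus)
qed (auto simp: free_alg_add free_alg_mult free_alg_zero free_alg_single fa_mult_assoc fa_mult_one
    fa_mult_add_left fa_mult_add_right add_ac)

lemma free_alg_a_inv:
  fixes p :: "'k::comm_ring_1 fa"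
  assumes "p \<in> carrier (free_alg n)"
  shows "\<ominus>\<^bsub>free_alg n\<^esub> p = - p"
proof -
  interpret F: ring "free_alg n :: 'k fa ring" by (rule free_alg_ring)
  show ?thesis using assms free_alg_uminus by (intro F.minus_equality) auto
qed

section \<open>The relation ideal\<close>

context quantum_weyl
begin

abbreviation F :: "'k fa ring" where "F \<equiv> free_alg n"

abbreviation rel_ideal :: "'k fa set" where "rel_ideal \<equiv> genideal F (qwa_rels n q lam)"

abbreviation torus_map :: "'k fa \<Rightarrow> ((nat \<Rightarrow>\<^sub>0 int) \<Rightarrow>\<^sub>0 'k)" where
  "torus_map \<equiv> free_eval torus_gen"

definition swap_rel :: "gen \<Rightarrow> gen \<Rightarrow> 'k fa" where
  "swap_rel g h = single [g, h] 1 - single [h, g] (swap_coeff g h)"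

definition weyl_rel :: "nat \<Rightarrow> 'k fa" where
  "weyl_rel i = single [X i, Y i] 1 - single [Y i, X i] (q i) - single [] 1"

lemma swap_rel_eqs:
  assumes "i \<in> {1..n}" "j \<in> {1..n}"
  shows "fa_mult (fa_x i) (fa_x j) - fa_mult (fa_sc (lam i j)) (fa_mult (fa_x j) (fa_x i))
      = swap_rel (X i) (X j)"
    and "fa_mult (fa_y j) (fa_y i) - fa_mult (fa_sc (lam j i)) (fa_mult (fa_y i) (fa_y j))
      = swap_rel (Y j) (Y i)"
    and "fa_mult (fa_x i) (fa_y j) - fa_mult (fa_sc (lam j i)) (fa_mult (fa_y j) (fa_x i))
      = swap_rel (X i) (Y j)"
    and "fa_mult (fa_x j) (fa_y i) - fa_mult (fa_sc (lam i j)) (fa_mult (fa_y i) (fa_x j))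
      = swap_rel (X j) (Y i)"
  using assms lam_inv[of i j] lam_inv[of j i]
  by (simp_all add: swap_rel_def swap_coeff_def fa_x_def fa_y_def fa_gen_def fa_mult_single
      fa_sc_mult_single power_int_minus)

lemma weyl_rel_eq:
  "fa_mult (fa_x i) (fa_y i) - fa_mult (fa_sc (q i)) (fa_mult (fa_y i) (fa_x i)) - fa_sc 1
    = weyl_rel i"
  by (simp add: weyl_rel_def fa_x_def fa_y_def fa_gen_def fa_mult_single fa_sc_mult_single)
    (simp add: fa_sc_def)

lemma qwa_rels_cases:
  assumes "p \<in> qwa_rels n q lam"
  obtains (swap) g h where "g \<in> gens n" "h \<in> gens n" "gen_index g \<noteq> gen_index h" "p = swap_rel g h"
  | (weyl) i where "i \<in> {1..n}" "p = weyl_rel i"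
  using assms unfolding qwa_rels_def
  by (elim UnE CollectE exE conjE; simp add: swap_rel_eqs weyl_rel_eq)
    (erule swap[rotated 3] weyl[rotated 1]; simp add: gens_iff)+

lemma weyl_rel_in_rels: "i \<in> {1..n} \<Longrightarrow> weyl_rel i \<in> qwa_rels n q lam"
  unfolding qwa_rels_def by (auto simp flip: weyl_rel_eq)

lemma swap_rel_in_rels:
  assumes "g \<in> gens n" "h \<in> gens n" "gen_index g \<noteq> gen_index h"
  shows "swap_rel g h \<in> qwa_rels n q lam \<or> swap_rel h g \<in> qwa_rels n q lam"
proof -
  have "swap_rel (X i) (X j) \<in> qwa_rels n q lam" "swap_rel (Y j) (Y i) \<in> qwa_rels n q lam"
    "swap_rel (X i) (Y j) \<in> qwa_rels n q lam" "swap_rel (X j) (Y i) \<in> qwa_rels n q lam"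
    if "1 \<le> i" "i < j" "j \<le> n" for i j
  proof -
    have ij: "i \<in> {1..n}" "j \<in> {1..n}" using that by auto
    show "swap_rel (X i) (X j) \<in> qwa_rels n q lam" "swap_rel (Y j) (Y i) \<in> qwa_rels n q lam"
      "swap_rel (X i) (Y j) \<in> qwa_rels n q lam" "swap_rel (X j) (Y i) \<in> qwa_rels n q lam"
      unfolding swap_rel_eqs[OF ij, symmetric] qwa_rels_def using that by blast+
  qed
  then show ?thesis
    using assms by (cases g; cases h) (auto simp: gens_iff neq_iff)
qed

lemma rels_carrier: "qwa_rels n q lam \<subseteq> carrier F"
proof
  fix p assume "p \<in> qwa_rels n q lam"
  then show "p \<in> carrier F"
    by (cases rule: qwa_rels_cases)
      (auto simp: swap_rel_def weyl_rel_def gens_iff intro!: free_alg_diff free_alg_single)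
qed

lemma torus_map_rels:
  assumes "p \<in> qwa_rels n q lam"
  shows "torus_map p = 0"
  using assms
proof (cases rule: qwa_rels_cases)
  case (swap g h)
  then show ?thesis
    by (simp add: swap_rel_def free_eval_diff free_eval_single torus_gen_swap[of g h])
next
  case (weyl i)
  then show ?thesis
    by (simp add: weyl_rel_def free_eval_diff free_eval_single torus_weyl_relation
        del: torus_gen.simps)
qed

sublocale F: ring F by (rule free_alg_ring)

sublocale rel_ideal: ideal rel_ideal F
  by (rule F.genideal_ideal[OF rels_carrier])

lemma torus_map_mult: "torus_map (fa_mult p r) = torus_map p \<star> torus_map r"
  unfolding fa_mult_eq_twisted_mult by (rule free_eval_mult)

lemma torus_map_fa_sc: "torus_map (fa_sc c) = scalar c"
  by (simp add: fa_sc_def free_eval_single)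

lemma torus_map_gen: "torus_map (fa_gen g) = torus_gen g"
  by (simp add: fa_gen_def free_eval_single)

lemma torus_map_rel_ideal: "p \<in> rel_ideal \<Longrightarrow> torus_map p = 0"
proof -
  have "ideal {p \<in> carrier F. torus_map p = 0} F"
  proof (rule idealI[OF F.ring_axioms])
    show "subgroup {p \<in> carrier F. torus_map p = 0} (add_monoid F)"
    proof (rule F.add.subgroupI)
      show "\<ominus>\<^bsub>F\<^esub> p \<in> {p \<in> carrier F. torus_map p = 0}"
        if "p \<in> {p \<in> carrier F. torus_map p = 0}" for p
        using that by (simp add: free_alg_a_inv free_alg_uminus free_eval_uminus)
      show "{p \<in> carrier F. torus_map p = 0} \<noteq> {}" using free_alg_zero free_eval_zero by blast
    qed (auto simp: free_eval_add free_alg_add)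
  qed (auto simp: torus_map_mult free_alg_mult)
  then have "rel_ideal \<subseteq> {p \<in> carrier F. torus_map p = 0}"
    using torus_map_rels rels_carrier by (intro F.genideal_minimal) auto
  then show "p \<in> rel_ideal \<Longrightarrow> torus_map p = 0" by blast
qed

definition coset :: "'k fa \<Rightarrow> 'k fa set" where "coset p = rel_ideal +>\<^bsub>F\<^esub> p"

lemma coset_eq_iff: "coset p = coset r \<longleftrightarrow> p - r \<in> rel_ideal"
proof -
  have zero: "0 \<in> rel_ideal" using rel_ideal.zero_closed by simp
  have add: "x + y \<in> rel_ideal" if "x \<in> rel_ideal" "y \<in> rel_ideal" for x y
    using rel_ideal.a_closed[OF that] by simp
  have uminus: "- x \<in> rel_ideal" if "x \<in> rel_ideal" for x
    using rel_ideal.a_inv_closed[OF that] free_alg_a_inv[OF rel_ideal.a_Hcarr[OF that]] by simp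
  have mem: "s \<in> coset t \<longleftrightarrow> s - t \<in> rel_ideal" for s t
    unfolding coset_def a_r_coset_def' by (auto simp: algebra_simps intro!: bexI[of _ "s - t"])
  show ?thesis
  proof
    assume "coset p = coset r"
    then show "p - r \<in> rel_ideal" using mem[of p p] mem[of p r] zero by simp
  next
    assume pr: "p - r \<in> rel_ideal"
    have "s - p \<in> rel_ideal \<longleftrightarrow> s - r \<in> rel_ideal" for s
      using add[OF _ pr, of "s - p"] add[OF _ uminus[OF pr], of "s - r"] by auto
    then show "coset p = coset r" using mem by blast
  qed
qed

lemma coset_add_cong: "coset p = coset p' \<Longrightarrow> coset r = coset r' \<Longrightarrow> coset (p + r) = coset (p' + r')"
  using rel_ideal.a_closed[of "p - p'" "r - r'"] by (simp add: coset_eq_iff algebra_simps)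

lemma coset_mult_left_cong:
  "coset p = coset r \<Longrightarrow> s \<in> carrier F \<Longrightarrow> coset (fa_mult s p) = coset (fa_mult s r)"
  using rel_ideal.I_l_closed[of "p - r" s] by (simp add: coset_eq_iff fa_mult_diff_right)

lemma coset_mult_right_cong:
  "coset p = coset r \<Longrightarrow> s \<in> carrier F \<Longrightarrow> coset (fa_mult p s) = coset (fa_mult r s)"
  using rel_ideal.I_r_closed[of "p - r" s] by (simp add: coset_eq_iff fa_mult_diff_left)

lemma coset_scale_cong:
  "coset p = coset r \<Longrightarrow> coset (fa_mult (fa_sc c) p) = coset (fa_mult (fa_sc c) r)"
  by (rule coset_mult_left_cong[OF _ free_alg_fa_sc])

lemma coset_word_cong:
  assumes "coset (single u 1) = coset r" "set v \<subseteq> gens n" "set w \<subseteq> gens n"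
  shows "coset (single (v @ u @ w) 1) = coset (fa_mult (single v 1) (fa_mult r (single w 1)))"
proof -
  have "single v 1 \<in> carrier F" "single w 1 \<in> carrier F"
    using assms by (simp_all add: free_alg_single)
  from coset_mult_left_cong[OF coset_mult_right_cong[OF assms(1) this(2)] this(1)]
  show ?thesis by (simp add: fa_mult_single)
qed

section \<open>Ordered monomials\<close>

lemma coset_swap:
  assumes g: "g \<in> gens n" and h: "h \<in> gens n" and "gen_index g \<noteq> gen_index h"
  shows "coset (single [g, h] 1) = coset (single [h, g] (swap_coeff g h))"
  using swap_rel_in_rels[OF assms]
proof
  assume "swap_rel g h \<in> qwa_rels n q lam"
  then show ?thesis
    using F.genideal_self[OF rels_carrier] by (auto simp: coset_eq_iff swap_rel_def)
next
  assume "swap_rel h g \<in> qwa_rels n q lam"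
  then have "coset (single [h, g] 1) = coset (single [g, h] (swap_coeff h g))"
    using F.genideal_self[OF rels_carrier] by (auto simp: coset_eq_iff swap_rel_def)
  from coset_scale_cong[OF this, of "swap_coeff g h"] show ?thesis
    using swap_coeff_inverse[OF g h] swap_coeff_neq_0[OF g h] by (simp add: fa_sc_mult_single)
qed

lemma coset_move_past_word:
  assumes g: "g \<in> gens n" and w: "set w \<subseteq> gens n" "\<And>h. h \<in> set w \<Longrightarrow> gen_index h \<noteq> gen_index g"
  shows "\<exists>c. coset (single (g # w) 1) = coset (single (w @ [g]) c)"
  using w
proof (induction w)
  case Nil
  then show ?case by auto
next
  case (Cons h w)
  obtain c where c: "coset (single (g # w) 1) = coset (single (w @ [g]) c)" using Cons by auto
  have gh: "gen_index g \<noteq> gen_index h" "h \<in> gens n" "set w \<subseteq> gens n"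
    using Cons.prems(1) Cons.prems(2)[of h] by auto
  let ?d = "single [h] (swap_coeff g h)"
  have "coset (single (g # h # w) 1) = coset (fa_mult ?d (single (g # w) 1))"
    using coset_word_cong[OF coset_swap[OF g gh(2,1)], of "[]" w] gh(3)
    by (simp add: fa_mult_single)
  also have "\<dots> = coset (fa_mult ?d (single (w @ [g]) c))"
    using gh(2) by (intro coset_mult_left_cong[OF c] free_alg_single) simp
  also have "\<dots> = coset (single ((h # w) @ [g]) (swap_coeff g h * c))" by (simp add: fa_mult_single)
  finally show ?case by blast
qed

lemma coset_X_Y:
  assumes i: "i \<in> {1..n}"
  shows "coset (single [X i, Y i] 1) = coset (single [Y i, X i] (q i) + single [] 1)"
  using F.genideal_self[OF rels_carrier] weyl_rel_in_rels[OF i]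
  by (auto simp: coset_eq_iff weyl_rel_def diff_diff_eq)

lemma coset_X_Y_pow:
  assumes i: "i \<in> {1..n}"
  shows "coset (single (X i # replicate b (Y i)) 1)
    = coset (single (replicate b (Y i) @ [X i]) (q i ^ b)
        + single (replicate (b - 1) (Y i)) (\<Sum>k<b. q i ^ k))"
proof (induction b)
  case (Suc b)
  let ?y = "single [Y i] (q i)" and ?ys = "single (replicate b (Y i)) 1" and ?s = "\<Sum>k<b. q i ^ k"
  have gens: "set (replicate b (Y i)) \<subseteq> gens n" "set [Y i] \<subseteq> gens n"
    using i by (auto simp: gens_iff)
  have "coset (single (X i # replicate (Suc b) (Y i)) 1)
      = coset (fa_mult ?y (single (X i # replicate b (Y i)) 1) + ?ys)"
    using coset_word_cong[OF coset_X_Y[OF i], of "[]" "replicate b (Y i)"] gens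
    by (simp add: fa_mult_single fa_mult_add_left fa_mult_add_right)
  also have "\<dots> = coset (fa_mult ?y (single (replicate b (Y i) @ [X i]) (q i ^ b)
      + single (replicate (b - 1) (Y i)) ?s) + ?ys)"
    using gens by (intro coset_add_cong refl coset_mult_left_cong[OF Suc] free_alg_single)
  also have "\<dots> = coset (single (replicate (Suc b) (Y i) @ [X i]) (q i ^ Suc b)
      + single (replicate b (Y i)) (q i * ?s + 1))"
    by (cases b) (simp_all add: fa_mult_single fa_mult_add_right single_add add.assoc
        del: sum.lessThan_Suc)
  also have "q i * ?s + 1 = (\<Sum>k<Suc b. q i ^ k)"
    by (simp add: sum.lessThan_Suc_shift sum_distrib_left add.commute del: sum.lessThan_Suc)
  finally show ?case by simp
qed simp

definition pbw_block :: "(nat \<Rightarrow> nat \<times> nat) \<Rightarrow> nat \<Rightarrow> gen list" where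
  "pbw_block f i = replicate (snd (f i)) (Y i) @ replicate (fst (f i)) (X i)"

definition pbw :: "(nat \<Rightarrow> nat \<times> nat) \<Rightarrow> gen list" where
  "pbw f = concat (map (pbw_block f) [1..<Suc n])"

lemma gen_index_pbw_block: "g \<in> set (pbw_block f i) \<Longrightarrow> gen_index g = i"
  by (auto simp: pbw_block_def)

lemma pbw_update_factors:
  assumes j: "j \<in> {1..n}"
  obtains u v where "set u \<union> set v \<subseteq> gens n" "\<And>g. g \<in> set u \<union> set v \<Longrightarrow> gen_index g \<noteq> j"
    "\<And>a b. pbw (f(j := (a, b))) = u @ replicate b (Y j) @ replicate a (X j) @ v"
proof
  let ?words = "\<lambda>f js. concat (map (pbw_block f) js)"
  let ?u = "?words f [1..<j]" and ?v = "?words f [Suc j..<Suc n]"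
  have index: "gen_index g \<in> {1..<j} \<union> {Suc j..n}" if g: "g \<in> set ?u \<union> set ?v" for g
    using g by (auto simp del: upt_Suc dest!: gen_index_pbw_block)
  show "set ?u \<union> set ?v \<subseteq> gens n" "\<And>g. g \<in> set ?u \<union> set ?v \<Longrightarrow> gen_index g \<noteq> j"
    using index j by (force simp: gens_iff simp del: set_concat upt_Suc)+
  fix a b
  have "[1..<Suc n] = [1..<j] @ [j] @ [Suc j..<Suc n]"
    using upt_add_eq_append[of 1 j "Suc n - j"] upt_conv_Cons[of j "Suc n"] j
    by (simp del: upt_Suc)
  moreover have "?words (f(j := (a, b))) [1..<j] = ?u"
    "?words (f(j := (a, b))) [Suc j..<Suc n] = ?v"
    by (intro arg_cong[where f = concat] map_cong refl; simp add: pbw_block_def del: upt_Suc)+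
  ultimately show "pbw (f(j := (a, b))) = ?u @ replicate b (Y j) @ replicate a (X j) @ ?v"
    by (simp add: pbw_def pbw_block_def del: upt_Suc)
qed

lemma count_list_replicate: "count_list (replicate k x) y = (if x = y then k else 0)"
  by (induction k) auto

lemma count_list_pbw:
  assumes i: "i \<in> {1..n}"
  shows "count_list (pbw f) (X i) = fst (f i)" "count_list (pbw f) (Y i) = snd (f i)"
proof -
  obtain u v where uv: "\<And>g. g \<in> set u \<union> set v \<Longrightarrow> gen_index g \<noteq> i"
    "\<And>a b. pbw (f(i := (a, b))) = u @ replicate b (Y i) @ replicate a (X i) @ v"
    using pbw_update_factors[OF i] by metis
  have "pbw f = u @ replicate (snd (f i)) (Y i) @ replicate (fst (f i)) (X i) @ v"
    using uv(2)[of "fst (f i)" "snd (f i)"] by simp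
  moreover have "count_list u g = 0" "count_list v g = 0" if "gen_index g = i" for g
    using uv(1) that by (auto simp: count_list_0_iff)
  ultimately show "count_list (pbw f) (X i) = fst (f i)" "count_list (pbw f) (Y i) = snd (f i)"
    by (simp_all add: count_list_replicate)
qed

lemma pbw_gens: "set (pbw f) \<subseteq> gens n"
  using gen_index_pbw_block by (auto simp: pbw_def gens_iff)

subsection \<open>The ordered monomials span\<close>

definition reducible :: "'k fa \<Rightarrow> bool" where
  "reducible p \<longleftrightarrow> (\<exists>r. keys r \<subseteq> range pbw \<and> coset p = coset r)"

lemma reducible_cong: "coset p = coset r \<Longrightarrow> reducible r \<Longrightarrow> reducible p"
  by (simp add: reducible_def)

lemma reducible_pbw: "reducible (single (pbw f) c)"
  unfolding reducible_def by (intro exI[of _ "single (pbw f) c"]) simp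

lemma reducible_add:
  assumes "reducible p" "reducible p'"
  shows "reducible (p + p')"
proof -
  obtain r r' where r: "keys r \<subseteq> range pbw" "coset p = coset r"
    and r': "keys r' \<subseteq> range pbw" "coset p' = coset r'"
    using assms unfolding reducible_def by blast
  have "keys (r + r') \<subseteq> range pbw"
    using Poly_Mapping.keys_add[of r r'] r(1) r'(1) by blast
  then show ?thesis
    unfolding reducible_def using coset_add_cong[OF r(2) r'(2)] by blast
qed

lemma reducible_scale:
  assumes "reducible p"
  shows "reducible (fa_mult (fa_sc c) p)"
proof -
  obtain r where r: "keys r \<subseteq> range pbw" "coset p = coset r"
    using assms unfolding reducible_def by blast
  have "keys (fa_mult (fa_sc c) r) \<subseteq> keys r"
    using keys_twisted_mult[of "(@)" "\<lambda>_ _. 1" "fa_sc c" r]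
    by (auto simp: fa_mult_eq_twisted_mult fa_sc_def split: if_splits)
  then show ?thesis
    unfolding reducible_def using r(1) coset_scale_cong[OF r(2)] by blast
qed

lemma reducible_gen_pbw:
  assumes g: "g \<in> gens n"
  shows "reducible (single (g # pbw f) 1)"
proof -
  define j where "j = gen_index g"
  have j: "j \<in> {1..n}" using g by (simp add: j_def gens_iff)
  obtain u v where uv: "set u \<union> set v \<subseteq> gens n" "\<And>h. h \<in> set u \<union> set v \<Longrightarrow> gen_index h \<noteq> j"
    and pbw: "\<And>a b. pbw (f(j := (a, b))) = u @ replicate b (Y j) @ replicate a (X j) @ v"
    using pbw_update_factors[OF j] by metis
  obtain a b where "f j = (a, b)" by fastforce
  then have f: "pbw f = u @ replicate b (Y j) @ replicate a (X j) @ v"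
    using pbw[of a b] by (simp add: fun_upd_idem)
  let ?tail = "replicate b (Y j) @ replicate a (X j) @ v"
  have tail: "set ?tail \<subseteq> gens n" using uv(1) j by (auto simp: gens_iff)
  obtain c where c: "coset (single (g # u) 1) = coset (single (u @ [g]) c)"
    using coset_move_past_word[OF g, of u] uv j_def by auto
  have moved: "coset (single (g # pbw f) 1) = coset (fa_mult (fa_sc c) (single (u @ g # ?tail) 1))"
    using coset_word_cong[OF c, of "[]" ?tail] tail
    by (simp add: f fa_mult_single fa_sc_mult_single)
  have "reducible (single (u @ g # ?tail) 1)"
  proof (cases g)
    case (Y i)
    then have "g = Y j" by (simp add: j_def)
    then have "u @ g # ?tail = pbw (f(j := (a, Suc b)))" by (simp add: pbw)
    then show ?thesis using reducible_pbw by metis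
  next
    case (X i)
    then have "g = X j" by (simp add: j_def)
    then have "coset (single (u @ g # ?tail) 1)
        = coset (single (pbw (f(j := (Suc a, b)))) (q j ^ b)
          + single (pbw (f(j := (a, b - 1)))) (\<Sum>k<b. q j ^ k))"
      using coset_word_cong[OF coset_X_Y_pow[OF j, of b], of u "replicate a (X j) @ v"] uv(1) j
      by (simp add: pbw fa_mult_single fa_mult_add_left fa_mult_add_right gens_iff
          set_replicate_conv_if)
    then show ?thesis by (rule reducible_cong[OF _ reducible_add[OF reducible_pbw reducible_pbw]])
  qed
  then show ?thesis by (rule reducible_cong[OF moved reducible_scale])
qed

lemma reducible_gen_mult:
  assumes g: "g \<in> gens n" and p: "reducible p"
  shows "reducible (fa_mult (fa_gen g) p)"
proof -
  obtain r where r: "keys r \<subseteq> range pbw" "coset p = coset r"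
    using p unfolding reducible_def by blast
  have "reducible (fa_mult (fa_gen g) r)"
  proof (induction r rule: poly_mapping_induct)
    case zero
    show ?case unfolding reducible_def by (intro exI[of _ 0]) simp
  next
    case (single u c)
    then obtain f where "u = pbw f" using r(1) by blast
    then show ?case
      using reducible_scale[OF reducible_gen_pbw[OF g, of f], of c]
      by (simp add: fa_gen_def fa_mult_single fa_sc_mult_single)
  next
    case (add p r)
    then show ?case by (simp add: fa_mult_add_right reducible_add)
  qed
  moreover have "coset (fa_mult (fa_gen g) p) = coset (fa_mult (fa_gen g) r)"
    using g by (intro coset_mult_left_cong[OF r(2)]) (simp add: fa_gen_def free_alg_single)
  ultimately show ?thesis by (rule reducible_cong[rotated])
qed

lemma reducible_word: "set w \<subseteq> gens n \<Longrightarrow> reducible (single w 1)"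
proof (induction w)
  case Nil
  have "pbw (\<lambda>_. (0, 0)) = []" by (simp add: pbw_def pbw_block_def del: upt_Suc)
  then show ?case using reducible_pbw[of "\<lambda>_. (0, 0)" 1] by metis
next
  case (Cons g w)
  then show ?case
    using reducible_gen_mult[of g "single w 1"] by (simp add: fa_gen_def fa_mult_single)
qed

lemma free_alg_reducible: "p \<in> carrier F \<Longrightarrow> reducible p"
proof (induction rule: free_alg_induct)
  case (single w c)
  then show ?case using reducible_scale[OF reducible_word, of w c] by (simp add: fa_sc_mult_single)
qed (rule reducible_add)

subsection \<open>The ordered monomials are independent\<close>

lemma exp_word_lead:
  "x_exp (\<Sum>g\<leftarrow>w. gen_lead g) i = int (count_list w (X i)) - int (count_list w (Y i))"
  "z_exp (\<Sum>g\<leftarrow>w. gen_lead g) i = int (count_list w (Y i))"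
  by (induction w) (auto simp: gen_lead_def split: gen.split)

lemma torus_word_lead:
  assumes "set w \<subseteq> gens n"
  shows "word_eval torus_gen w \<noteq> 0" "lead_exp (word_eval torus_gen w) = (\<Sum>g\<leftarrow>w. gen_lead g)"
proof -
  have "(\<Sum>g\<leftarrow>w. lead_exp (torus_gen g)) = (\<Sum>g\<leftarrow>w. gen_lead g)"
    using assms lead_exp_torus_gen by (intro arg_cong[where f = sum_list] map_cong) auto
  then show "word_eval torus_gen w \<noteq> 0" "lead_exp (word_eval torus_gen w) = (\<Sum>g\<leftarrow>w. gen_lead g)"
    using word_eval_neq_0_lead_exp[of w torus_gen] assms torus_gen_neq_0 by auto
qed

lemma pbw_lead_inj: "inj_on (\<lambda>w. lead_exp (word_eval torus_gen w)) (range pbw)"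
proof (rule inj_onI; elim rangeE)
  fix w w' f f'
  assume "lead_exp (word_eval torus_gen w) = lead_exp (word_eval torus_gen w')"
    and w: "w = pbw f" "w' = pbw f'"
  then have "(\<Sum>g\<leftarrow>pbw f. gen_lead g) = (\<Sum>g\<leftarrow>pbw f'. gen_lead g)"
    using torus_word_lead(2)[OF pbw_gens] by metis
  then have "f i = f' i" if "i \<in> {1..n}" for i
    using exp_word_lead[of "pbw f" i] exp_word_lead[of "pbw f'" i] count_list_pbw[OF that]
    by (simp add: prod_eq_iff)
  then have "map (pbw_block f) [1..<Suc n] = map (pbw_block f') [1..<Suc n]"
    by (auto simp: pbw_block_def)
  then show "w = w'" unfolding w pbw_def by metis
qed

lemma rel_ideal_iff_torus_map:
  assumes p: "p \<in> carrier F"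
  shows "p \<in> rel_ideal \<longleftrightarrow> torus_map p = 0"
proof
  assume p0: "torus_map p = 0"
  obtain r where r: "keys r \<subseteq> range pbw" "coset p = coset r"
    using free_alg_reducible[OF p] unfolding reducible_def by blast
  then have pr: "p - r \<in> rel_ideal" by (simp add: coset_eq_iff)
  then have "torus_map r = 0" using torus_map_rel_ideal p0 by (fastforce simp: free_eval_diff)
  then have "r = 0"
    using r(1) torus_word_lead(1)[OF pbw_gens] inj_on_subset[OF pbw_lead_inj]
    by (intro free_eval_eq_0_imp_eq_0) auto
  then show "p \<in> rel_ideal" using pr by simp
qed (rule torus_map_rel_ideal)

lemma coset_eq_iff_torus_map:
  "p \<in> carrier F \<Longrightarrow> r \<in> carrier F \<Longrightarrow> coset p = coset r \<longleftrightarrow> torus_map p = torus_map r"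
  by (simp add: coset_eq_iff rel_ideal_iff_torus_map free_alg_diff free_eval_diff)

section \<open>Rigidity of the multiparameter quantum Weyl algebra\<close>

abbreviation A :: "'k fa set ring" where "A \<equiv> qwa n q lam"

abbreviation sc :: "'k \<Rightarrow> 'k fa set" where "sc \<equiv> qwa_sc n q lam"

lemma coset_hom: "coset \<in> ring_hom F A"
  using rel_ideal.rcos_ring_hom unfolding qwa_def coset_def[abs_def] .

lemma carrier_qwa: "carrier A = coset ` carrier F"
  by (auto simp: qwa_def FactRing_def A_RCOSETS_def' coset_def)

lemma sc_eq_coset: "sc c = coset (fa_sc c)"
  by (simp add: qwa_sc_def coset_def)

sublocale A: ring A
  unfolding qwa_def by (rule rel_ideal.quotient_is_ring)

lemma qwa_mult: "p \<in> carrier F \<Longrightarrow> r \<in> carrier F \<Longrightarrow> coset p \<otimes>\<^bsub>A\<^esub> coset r = coset (fa_mult p r)"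
  using ring_hom_mult[OF coset_hom, of p r] by simp

lemma qwa_add: "p \<in> carrier F \<Longrightarrow> r \<in> carrier F \<Longrightarrow> coset p \<oplus>\<^bsub>A\<^esub> coset r = coset (p + r)"
  using ring_hom_add[OF coset_hom, of p r] by simp

lemma qwa_one: "\<one>\<^bsub>A\<^esub> = coset (fa_sc 1)"
  using ring_hom_one[OF coset_hom] by (simp add: fa_sc_def)

lemma qwa_zero: "\<zero>\<^bsub>A\<^esub> = coset 0"
  using ring_hom_zero[OF coset_hom F.ring_axioms A.ring_axioms] by simp

lemma coset_closed: "p \<in> carrier F \<Longrightarrow> coset p \<in> carrier A"
  by (rule ring_hom_closed[OF coset_hom])

lemma coset_eq_zero_iff: "p \<in> carrier F \<Longrightarrow> coset p = \<zero>\<^bsub>A\<^esub> \<longleftrightarrow> torus_map p = 0"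
  unfolding qwa_zero by (simp add: coset_eq_iff_torus_map free_alg_zero)

lemma qwa_cases:
  assumes "a \<in> carrier A"
  obtains p where "p \<in> carrier F" "a = coset p"
  using assms by (auto simp: carrier_qwa)

lemmas coset_simps = qwa_mult qwa_add coset_eq_iff_torus_map coset_closed coset_eq_zero_iff
  free_alg_fa_sc free_alg_mult free_alg_add torus_map_mult torus_map_fa_sc free_eval_add

sublocale A: scalar_algebra A sc
proof
  fix c d
  show "sc c \<in> carrier A" by (simp add: sc_eq_coset coset_simps)
  show "sc (c + d) = sc c \<oplus>\<^bsub>A\<^esub> sc d" by (simp add: sc_eq_coset coset_simps scalar_add)
  show "sc (c * d) = sc c \<otimes>\<^bsub>A\<^esub> sc d" by (simp add: sc_eq_coset coset_simps scalar_mult)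
  show "sc 1 = \<one>\<^bsub>A\<^esub>" by (simp add: sc_eq_coset qwa_one)
  show "sc c \<in> ring_center A"
    unfolding ring_center_def sc_eq_coset
  proof (intro CollectI conjI ballI)
    fix a assume "a \<in> carrier A"
    then obtain p where "p \<in> carrier F" "a = coset p" by (rule qwa_cases)
    then show "coset (fa_sc c) \<otimes>\<^bsub>A\<^esub> a = a \<otimes>\<^bsub>A\<^esub> coset (fa_sc c)"
      by (simp add: coset_simps scalar_commute)
  qed (simp add: coset_simps)
qed

sublocale A: noncomm_domain A
proof
  show "\<one>\<^bsub>A\<^esub> \<noteq> \<zero>\<^bsub>A\<^esub>"
    using torus_word_lead(1)[of "[]"] by (simp add: qwa_one coset_simps)
  show "a = \<zero>\<^bsub>A\<^esub> \<or> b = \<zero>\<^bsub>A\<^esub>"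
    if "a \<in> carrier A" "b \<in> carrier A" "a \<otimes>\<^bsub>A\<^esub> b = \<zero>\<^bsub>A\<^esub>" for a b
    using that tw_mult_neq_0 by (elim qwa_cases) (auto simp: coset_simps)
qed

definition fa_z :: "nat \<Rightarrow> 'k fa" where
  "fa_z i = fa_mult (fa_sc (q i - 1)) (fa_mult (fa_y i) (fa_x i)) + fa_sc 1"

lemma fa_gen_carrier: "g \<in> gens n \<Longrightarrow> fa_gen g \<in> carrier F"
  by (simp add: fa_gen_def free_alg_single)

lemma fa_z_carrier: "i \<in> {1..n} \<Longrightarrow> fa_z i \<in> carrier F"
  by (simp add: fa_z_def fa_x_def fa_y_def free_alg_add free_alg_mult free_alg_fa_sc
      fa_gen_carrier gens_iff)

lemma torus_map_fa_z:
  assumes i: "i \<in> {1..n}"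
  shows "torus_map (fa_z i) = torus_z i"
proof -
  have "torus_map (fa_z i)
      = scalar (q i - 1) \<star> (scalar (inverse (q i - 1)) \<star> (torus_z i - scalar 1)) + scalar 1"
    by (simp only: fa_z_def fa_x_def fa_y_def free_eval_add torus_map_mult torus_map_fa_sc
        torus_map_gen torus_gen_Y_X[OF i])
  also have "\<dots> = torus_z i"
    using q_minus_1_nz[OF i] by (simp only: tw_assoc[symmetric] scalar_mult) simp
  finally show ?thesis .
qed

lemma keys_torus_map:
  assumes "p \<in> carrier F"
  shows "keys (torus_map p) \<subseteq> torus_exps n"
proof (rule keys_free_eval, rule keys_word_eval)
  fix w g assume "w \<in> keys p" "g \<in> set w"
  then have g: "g \<in> gens n" using assms by (auto simp: mem_free_alg)
  have "supported_at (gen_index g) (gen_sign g) \<subseteq> torus_exps n"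
    using g by (auto simp: supported_at_def torus_exps_def gens_iff)
  then show "keys (torus_gen g) \<subseteq> torus_exps n" using keys_torus_gen_supported[OF g] by blast
qed (simp_all add: torus_exps_def)

lemma qwa_same_twist_proportional:
  assumes twist: "same_twist A a b" and b: "b \<noteq> \<zero>\<^bsub>A\<^esub>"
  shows "\<exists>c. a = sc c \<otimes>\<^bsub>A\<^esub> b"
proof -
  have "a \<in> carrier A" "b \<in> carrier A" using twist by (simp_all add: same_twist_def)
  then obtain p r where p: "p \<in> carrier F" "a = coset p" and r: "r \<in> carrier F" "b = coset r"
    by (meson qwa_cases)
  have torus_twist: "common_twist (torus_map p) (torus_map r) (torus_map s)"
    if s: "s \<in> carrier F" for s
  proof -
    obtain s' where "s' \<in> carrier F" "a \<otimes>\<^bsub>A\<^esub> coset s = coset s' \<otimes>\<^bsub>A\<^esub> a"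
      "b \<otimes>\<^bsub>A\<^esub> coset s = coset s' \<otimes>\<^bsub>A\<^esub> b"
      using twist coset_closed[OF s] unfolding same_twist_def by (metis qwa_cases)
    then show ?thesis using s p r by (auto simp: coset_simps common_twist_def)
  qed
  have "\<exists>c. torus_map p = scalar c \<star> torus_map r"
  proof (rule torus_same_twist_proportional)
    show "torus_map r \<noteq> 0" using b r by (simp add: coset_eq_zero_iff)
    fix i assume i: "i \<in> {1..n}"
    show "common_twist (torus_map p) (torus_map r) (torus_z i)"
      using torus_twist[OF fa_z_carrier[OF i]] by (simp only: torus_map_fa_z[OF i])
    show "common_twist (torus_map p) (torus_map r) (torus_gen (X i))"
      using torus_twist[OF fa_gen_carrier[of "X i"]] i
      by (simp only: torus_map_gen gens_iff gen_index.simps)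
  qed (use p r keys_torus_map in blast)+
  then show ?thesis using p r by (auto simp: sc_eq_coset coset_simps)
qed

lemma qwa_generated:
  assumes S: "subring S A" "\<And>c. sc c \<in> S" "\<And>g. g \<in> gens n \<Longrightarrow> coset (fa_gen g) \<in> S"
  shows "carrier A \<subseteq> S"
proof -
  note S_mult = subringE(6)[OF S(1)] and S_add = subringE(7)[OF S(1)]
  have word: "coset (single w 1) \<in> S" if "set w \<subseteq> gens n" for w
    using that
  proof (induction w)
    case Nil
    then show ?case using S(2)[of 1] by (simp add: sc_eq_coset fa_sc_def)
  next
    case (Cons g w)
    then have "coset (fa_gen g) \<otimes>\<^bsub>A\<^esub> coset (single w 1) \<in> S" using S(3) S_mult by simp
    then show ?case
      using Cons.prems by (simp add: qwa_mult fa_gen_def free_alg_single fa_mult_single)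
  qed
  have "coset p \<in> S" if "p \<in> carrier F" for p
    using that
  proof (induction rule: free_alg_induct)
    case (single w c)
    then have "coset (fa_sc c) \<otimes>\<^bsub>A\<^esub> coset (single w 1) \<in> S"
      using word S(2) S_mult by (simp flip: sc_eq_coset)
    then show ?case
      using single by (simp add: qwa_mult free_alg_single free_alg_fa_sc fa_sc_mult_single)
  next
    case (add p r)
    then show ?case using S_add[of "coset p" "coset r"] by (simp add: qwa_add)
  qed
  then show ?thesis by (auto simp: carrier_qwa)
qed

lemma qwa_normal_z:
  assumes i: "i \<in> {1..n}"
  shows "normal_elem A (coset (fa_z i))"
  unfolding normal_elem_def
proof
  let ?z = "coset (fa_z i)"
  show z: "?z \<in> carrier A" by (rule coset_closed[OF fa_z_carrier[OF i]])
  show "carrier A \<subseteq> normalized_by A ?z"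
  proof (rule qwa_generated)
    show "subring (normalized_by A ?z) A" by (rule A.normalized_by_subring[OF z])
    show "sc c \<in> normalized_by A ?z" for c
      using A.iota_commute[OF z, of c] by (auto simp: normalized_by_def intro!: bexI[of _ "sc c"])
    fix g assume g: "g \<in> gens n"
    obtain c where "torus_z i \<star> torus_gen g = scalar c \<star> (torus_gen g \<star> torus_z i)"
      using torus_gen_z_commute[OF g i] by blast
    then have "?z \<otimes>\<^bsub>A\<^esub> coset (fa_gen g) = coset (fa_mult (fa_sc c) (fa_gen g)) \<otimes>\<^bsub>A\<^esub> ?z"
      using fa_gen_carrier[OF g] fa_z_carrier[OF i]
      by (simp add: coset_simps torus_map_gen torus_map_fa_z[OF i] tw_assoc)
    then show "coset (fa_gen g) \<in> normalized_by A ?z"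
      using fa_gen_carrier[OF g] unfolding normalized_by_def
      by (auto simp: coset_closed free_alg_mult free_alg_fa_sc)
  qed
qed

lemma qwa_y_x:
  assumes i: "i \<in> {1..n}"
  shows "coset (fa_y i) \<otimes>\<^bsub>A\<^esub> coset (fa_x i)
      = sc (inverse (q i - 1)) \<otimes>\<^bsub>A\<^esub> (coset (fa_z i) \<oplus>\<^bsub>A\<^esub> sc (- 1))"
    and "coset (fa_y i) \<otimes>\<^bsub>A\<^esub> coset (fa_x i) \<noteq> \<zero>\<^bsub>A\<^esub>"
proof -
  have xy: "fa_gen (X i) \<in> carrier F" "fa_gen (Y i) \<in> carrier F"
    using i by (simp_all add: fa_gen_carrier gens_iff)
  have "torus_z i + scalar (- 1) = torus_z i - scalar 1" by (simp add: scalar_def single_uminus)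
  then show "coset (fa_y i) \<otimes>\<^bsub>A\<^esub> coset (fa_x i)
      = sc (inverse (q i - 1)) \<otimes>\<^bsub>A\<^esub> (coset (fa_z i) \<oplus>\<^bsub>A\<^esub> sc (- 1))"
    using xy fa_z_carrier[OF i]
    by (simp add: fa_x_def fa_y_def sc_eq_coset coset_simps torus_map_gen torus_map_fa_z[OF i]
        torus_gen_Y_X[OF i] del: torus_gen.simps)
  show "coset (fa_y i) \<otimes>\<^bsub>A\<^esub> coset (fa_x i) \<noteq> \<zero>\<^bsub>A\<^esub>"
    using xy tw_mult_neq_0 torus_gen_neq_0[of "X i"] torus_gen_neq_0[of "Y i"] i
    by (simp add: fa_x_def fa_y_def coset_simps torus_map_gen gens_iff del: torus_gen.simps)
qed

sublocale A: rigid_algebra A sc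
proof
  show "\<exists>c. a = sc c \<otimes>\<^bsub>A\<^esub> b" if "same_twist A a b" "b \<noteq> \<zero>\<^bsub>A\<^esub>" for a b
    using that by (rule qwa_same_twist_proportional)
  fix S assume S: "subring S A" "\<And>c. sc c \<in> S" "factor_closed A S"
    and normal: "\<And>z. normal_elem A z \<Longrightarrow> z \<noteq> \<zero>\<^bsub>A\<^esub> \<Longrightarrow> z \<in> S"
  have "coset (fa_y i) \<in> S \<and> coset (fa_x i) \<in> S" if i: "i \<in> {1..n}" for i
  proof -
    have "coset (fa_z i) \<in> S"
      using normal[OF qwa_normal_z[OF i]] fa_z_carrier[OF i] torus_z_neq_0
      by (simp add: coset_eq_zero_iff torus_map_fa_z[OF i])
    then have "coset (fa_z i) \<oplus>\<^bsub>A\<^esub> sc (- 1) \<in> S"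
      by (rule subringE(7)[OF S(1) _ S(2)])
    then have "coset (fa_y i) \<otimes>\<^bsub>A\<^esub> coset (fa_x i) \<in> S"
      unfolding qwa_y_x(1)[OF i] by (rule subringE(6)[OF S(1) S(2)])
    moreover have "coset (fa_x i) \<in> carrier A" "coset (fa_y i) \<in> carrier A"
      using i by (simp_all add: fa_x_def fa_y_def coset_closed fa_gen_carrier gens_iff)
    ultimately show ?thesis using S(3) qwa_y_x(2)[OF i] unfolding factor_closed_def by blast
  qed
  then have "coset (fa_gen g) \<in> S" if "g \<in> gens n" for g
    using that by (cases g) (simp_all add: fa_x_def fa_y_def gens_iff)
  then show "carrier A \<subseteq> S" by (rule qwa_generated[OF S(1,2)])
qed

end

theorem theorem2p5:
  fixes n :: nat and q :: "nat \<Rightarrow> 'k::field" and lam :: "nat \<Rightarrow> nat \<Rightarrow> 'k"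
  defines "A \<equiv> qwa n q lam"
      and "\<iota> \<equiv> qwa_sc n q lam"
      and "P \<equiv> UP (qwa n q lam)"
  defines "\<iota>P \<equiv> (\<lambda>c. monom P (\<iota> c) 0)"
      and "t \<equiv> monom P \<one>\<^bsub>A\<^esub> 1"
  assumes n1: "n \<ge> 1"
      and q_nz: "\<forall>i\<in>{1..n}. q i \<noteq> 0"
      and lam_nz: "\<forall>i\<in>{1..n}. \<forall>j\<in>{1..n}. lam i j \<noteq> 0"
      and lam_inv: "\<forall>i\<in>{1..n}. \<forall>j\<in>{1..n}. lam i j = inverse (lam j i)"
      and lam_diag: "\<forall>i\<in>{1..n}. lam i i = 1"
      and q_not_root: "\<forall>k\<in>{1..n}. \<forall>m::nat. m \<ge> 1 \<longrightarrow> q k ^ m \<noteq> 1"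
  shows "(\<forall>h\<in>alg_aut P \<iota>P. \<exists>g\<in>alg_aut A \<iota>. \<exists>c r. c \<noteq> 0 \<and>
             (\<forall>a\<in>carrier A. h (monom P a 0) = monom P (g a) 0) \<and>
             h t = monom P (\<iota> c) 1 \<oplus>\<^bsub>P\<^esub> monom P (\<iota> r) 0)
       \<and> (\<forall>g\<in>alg_aut A \<iota>. \<forall>c r. c \<noteq> 0 \<longrightarrow> (\<exists>h\<in>alg_aut P \<iota>P.
             (\<forall>a\<in>carrier A. h (monom P a 0) = monom P (g a) 0) \<and>
             h t = monom P (\<iota> c) 1 \<oplus>\<^bsub>P\<^esub> monom P (\<iota> r) 0))
       \<and> (CHAR('k) = 0 \<longrightarrow>
             (\<forall>d. alg_derivation A \<iota> d \<and> locally_nilpotent A d \<longrightarrow>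
                  (\<forall>a\<in>carrier A. d a = \<zero>\<^bsub>A\<^esub>)))"
proof -
  interpret W: quantum_weyl n q lam
    using q_nz lam_nz lam_inv q_not_root by unfold_locales blast+
  interpret UP_rigid_algebra A P \<iota>
    unfolding A_def P_def \<iota>_def by unfold_locales
  show ?thesis
    unfolding \<iota>P_def t_def
    using alg_aut_triangular[unfolded triangular_def] triangular_aut_exists[unfolded triangular_def]
      locally_nilpotent_derivation_eq_0
    by (intro conjI ballI allI impI) simp_all
qed

end
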